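(* Let $d\in\mathbb{N}$, $n\in\mathbb{N}$, $0<\beta<1$ and $0<\alpha<2$, and let $B^{\beta,\alpha}=\{B^{\beta,\alpha}(t),\,t\ge 0\}$ be the $d$-dimensional generalized grey Brownian motion. Let its squared radius of gyration and its mean square end-to-end length be $$\left(R_{g}^{\beta,\alpha}\right)^{2}:=\frac{1}{2}\frac{1}{n^{2}}\int_{0}^{n}dt\int_{0}^{n}ds\,\mathbb{E}\left(\left|B^{\beta,\alpha}(t)-B^{\beta,\alpha}(s)\right|^{2}\right),\qquad \left(R_{e}^{\beta,\alpha}\right)^{2}:=\mathbb{E}\left(\left|B^{\beta,\alpha}(n)-B^{\beta,\alpha}(0)\right|^{2}\right).$$ Then the radius of gyration, obtained by expanding the form factor $S^{\beta,\alpha}(k)$ of $B^{\beta,\alpha}$ to lowest order in $k$, is $$\left(R_{g}^{\beta,\alpha}\right)^{2}=\frac{n^{\alpha}}{\Gamma(\beta+1)(\alpha+1)(\alpha+2)},$$ and with $$\left(R_{e}^{\beta,\alpha}\right)^{2}=\mathbb{E}\left(\left(B^{\beta,\alpha}(n)\right)^{2}\right)=\frac{n^{\alpha}}{\Gamma(\beta+1)}$$ one has $$\frac{\left(R_{e}^{\beta,\alpha}\right)^{2}}{(\alpha+1)(\alpha+2)}=\left(R_{g}^{\beta,\alpha}\right)^{2}.$$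
   Context: Mittag-Leffler function: $E_{\beta}(z)=\sum_{j=0}^{\infty}\frac{z^{j}}{\Gamma(\beta j+1)}$, $z\in\mathbb{C}$, $\beta>0$. Mittag-Leffler measure: let $S_{d}=S(\mathbb{R})\otimes\mathbb{R}^{d}$ (Schwartz functions $\varphi=(\varphi_{1},\dots,\varphi_{d})$) with dual $S_{d}'=S'(\mathbb{R})\otimes\mathbb{R}^{d}$ (elements $w=(w_1,\dots,w_d)$), dual pairing $\langle w,\varphi\rangle_{0}=\sum_{j=1}^{d}\langle w_{j},\varphi_{j}\rangle$ extending the $L^2$ inner product, and norm $|\varphi|_{0}^{2}=\sum_{j=1}^{d}|\varphi_{j}|_{L^{2}(\mathbb{R})}^{2}$. For $\beta\in(0,1]$, $\mu_{\beta}$ is the unique probability measure on $S_{d}'$ (with the $\sigma$-algebra generated by the cylinder sets) such that $\int_{S_{d}'}e^{i\langle w,\varphi\rangle_{0}}\,d\mu_{\beta}(w)=E_{\beta}\left(-\frac{1}{2}|\varphi|_{0}^{2}\right)$ for all $\varphi\in S_{d}$. Expectation $\mathbb{E}$ is with respect to $\mu_{\beta}$. Since $\int\langle w,\varphi\rangle_{0}^{2}\,d\mu_{\beta}(w)=\frac{1}{\Gamma(\beta+1)}|\varphi|_{0}^{2}$, the map $\varphi\mapsto\langle\cdot,\varphi\rangle_{0}\in L^{2}(\mu_{\beta})$ extends by continuity to all $\varphi\in L^{2}(\mathbb{R})\otimes\mathbb{R}^{d}$. The operator $M_{-}^{\alpha/2}$: $M_{-}^{\alpha/2}\varphi=K_{\alpha/2}D_{-}^{-(\alpha-1)/2}\varphi$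 for $\alpha\in(0,1)$, $M_{-}^{\alpha/2}\varphi=\varphi$ for $\alpha=1$, and $M_{-}^{\alpha/2}\varphi=K_{\alpha/2}I_{-}^{(\alpha-1)/2}\varphi$ for $\alpha\in(1,2)$, with $K_{\alpha/2}=\sqrt{\alpha\sin(\alpha\pi/2)\Gamma(\alpha)}$ and the Riemann-Liouville operators $(D_{-}^{r}f)(x)=\frac{1}{\Gamma(1-r)}\frac{d}{dx}\int_{-\infty}^{x}f(t)(x-t)^{-r}dt$, $(I_{-}^{r}f)(x)=\frac{1}{\Gamma(r)}\int_{x}^{\infty}f(t)(t-x)^{r-1}dt$. Its domain is extended to include the indicator functions $1_{[0,t)}$, with $M_{-}^{\alpha/2}1_{[0,t)}\in L^{2}(\mathbb{R})$ and $\left(M_{-}^{\alpha/2}1_{[0,t)},M_{-}^{\alpha/2}1_{[0,s)}\right)_{L^{2}}=\frac{1}{2}\left(t^{\alpha}+s^{\alpha}-|t-s|^{\alpha}\right)$ for all $s,t\ge 0$. Generalized grey Brownian motion: for $0<\alpha<2$, $B^{\beta,\alpha}(t,w)=\left(\langle w_{1},M_{-}^{\alpha/2}1_{[0,t)}\rangle,\dots,\langle w_{d},M_{-}^{\alpha/2}1_{[0,t)}\rangle\right)$, as an element of $L^{2}(\mu_{\beta})$. It is $\alpha/2$-self-similar with stationary increments, and $\mathbb{E}\left(e^{i(k,B^{\beta,\alpha}(t)-B^{\beta,\alpha}(s))}\right)=E_{\beta}\left(-\frac{|k|^{2}}{2}|t-s|^{\alpha}\right)$ for $k\in\mathbb{R}^{d}$.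 Form factor: $S^{\beta,\alpha}(k)=\frac{1}{n^{2}}\int_{0}^{n}dt\int_{0}^{n}ds\,\mathbb{E}\left(e^{i(k,B^{\beta,\alpha}(t)-B^{\beta,\alpha}(s))}\right)=2\sum_{j=0}^{\infty}\frac{1}{\Gamma(\beta j+1)(\alpha j+1)(\alpha j+2)}\left(-\frac{n^{\alpha}|k|^{2}}{2}\right)^{j}$, $k\in\mathbb{R}^{d}$.
   Formalization: The closed forms for the squared radius of gyration and the mean square end-to-end length are stated with an additional factor d, since with the Euclidean norm on R^d the printed formulas hold only for d = 1; the form factor expansion and the ratio identity are as printed. *)

theory Defs
  imports "HOL-Probability.Probability" "HOL-Library.Landau_Symbols"
begin

definition mittag_leffler :: "real \<Rightarrow> complex \<Rightarrow> complex" where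
  "mittag_leffler \<beta> z = (\<Sum>j. z ^ j / of_real (Gamma (\<beta> * real j + 1)))"

definition schwartz :: "(real \<Rightarrow> real) set" where
  "schwartz = {f. (\<forall>k x. (deriv ^^ k) f field_differentiable at x) \<and>
                  (\<forall>m k. bdd_above (range (\<lambda>x. \<bar>x ^ m * (deriv ^^ k) f x\<bar>)))}"

definition schwartz_seminorm :: "nat \<Rightarrow> nat \<Rightarrow> (real \<Rightarrow> real) \<Rightarrow> real" where
  "schwartz_seminorm m k f = (SUP x. \<bar>x ^ m * (deriv ^^ k) f x\<bar>)"

definition schwartz_topology :: "(real \<Rightarrow> real) topology" where
  "schwartz_topology = topology_generated_by
     {{g \<in> schwartz. schwartz_seminorm m k (\<lambda>x. g x - f x) < e} | f m k e. f \<in> schwartz \<and> 0 < e}"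

text \<open>Functionals are totalised by \<^term>\<open>undefined\<close> outside the Schwartz space, so
  that equal functionals are equal as HOL functions.\<close>

definition tempered :: "((real \<Rightarrow> real) \<Rightarrow> real) set" where
  "tempered = {u \<in> extensional schwartz.
     (\<forall>f\<in>schwartz. \<forall>g\<in>schwartz. \<forall>a b. u (\<lambda>x. a * f x + b * g x) = a * u f + b * u g) \<and>
     continuous_map schwartz_topology euclideanreal u}"

text \<open>The space \<open>S\<^sub>d = S(\<real>) \<otimes> \<real>\<^sup>d\<close>, its dual, the pairing \<open>\<langle>w,\<phi>\<rangle>\<^sub>0\<close> and \<open>|\<phi>|\<^sub>0\<^sup>2\<close>;
  the dimension \<open>d\<close> is the cardinality of the index type.\<close>

type_synonym ('d) functional_vec = "((real \<Rightarrow> real) \<Rightarrow> real) ^ 'd"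

definition schwartz_vec :: "(real \<Rightarrow> real ^ 'd::finite) set" where
  "schwartz_vec = {\<phi>. \<forall>j. (\<lambda>x. \<phi> x $ j) \<in> schwartz}"

definition tempered_vec :: "'d::finite functional_vec set" where
  "tempered_vec = {w. \<forall>j. w $ j \<in> tempered}"

definition pairing :: "'d::finite functional_vec \<Rightarrow> (real \<Rightarrow> real ^ 'd) \<Rightarrow> real" where
  "pairing w \<phi> = (\<Sum>j\<in>UNIV. (w $ j) (\<lambda>x. \<phi> x $ j))"

definition norm0_sq :: "(real \<Rightarrow> real ^ 'd::finite) \<Rightarrow> real" where
  "norm0_sq \<phi> = (\<Sum>j\<in>UNIV. LBINT x. (\<phi> x $ j)\<^sup>2)"

definition cylinder_sets :: "'d::finite functional_vec set set" where
  "cylinder_sets = {{w \<in> tempered_vec. (\<lambda>i\<in>{..<m}. pairing w (\<phi> i)) \<in> A} | (m :: nat) \<phi> A.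
     (\<forall>i<m. \<phi> i \<in> schwartz_vec) \<and> A \<in> sets (Pi\<^sub>M {..<m} (\<lambda>_. borel))}"

text \<open>The conditions characterising \<open>\<mu>\<^sub>\<beta>\<close>; existence and uniqueness are the Bochner--Minlos theorem.\<close>

definition mittag_leffler_measure :: "real \<Rightarrow> 'd::finite functional_vec measure \<Rightarrow> bool" where
  "mittag_leffler_measure \<beta> \<mu> \<longleftrightarrow>
     prob_space \<mu> \<and> space \<mu> = tempered_vec \<and> sets \<mu> = sigma_sets tempered_vec cylinder_sets \<and>
     (\<forall>\<phi>\<in>schwartz_vec. (LINT w|\<mu>. exp (\<i> * of_real (pairing w \<phi>)))
                         = mittag_leffler \<beta> (of_real (- (norm0_sq \<phi> / 2))))"

text \<open>\<open>L2_pairing \<mu> \<phi> X\<close>: the random variable \<open>X\<close> is a version of \<open>\<langle>\<cdot>,\<phi>\<rangle>\<^sub>0 \<in> L\<^sup>2(\<mu>)\<close> for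
  \<open>\<phi> \<in> L\<^sup>2(\<real>) \<otimes> \<real>\<^sup>d\<close>, i.e. the \<open>L\<^sup>2(\<mu>)\<close>-limit of the pairings with Schwartz functions
  tending to \<open>\<phi>\<close> in \<open>L\<^sup>2\<close>.  By the isometry property up to a constant, the limit does not depend on
  the approximating sequence.\<close>

definition L2_pairing ::
  "'d::finite functional_vec measure \<Rightarrow> (real \<Rightarrow> real ^ 'd) \<Rightarrow> ('d functional_vec \<Rightarrow> real) \<Rightarrow> bool" where
  "L2_pairing \<mu> \<phi> X \<longleftrightarrow>
     \<phi> \<in> borel_measurable lborel \<and> integrable lborel (\<lambda>x. (norm (\<phi> x))\<^sup>2) \<and>
     X \<in> borel_measurable \<mu> \<and> integrable \<mu> (\<lambda>w. (X w)\<^sup>2) \<and>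
     (\<exists>\<psi>. (\<forall>i::nat. \<psi> i \<in> schwartz_vec) \<and>
          (\<lambda>i. norm0_sq (\<lambda>x. \<psi> i x - \<phi> x)) \<longlonglongrightarrow> 0 \<and>
          (\<lambda>i. LINT w|\<mu>. (pairing w (\<psi> i) - X w)\<^sup>2) \<longlonglongrightarrow> 0)"

text \<open>The derivative is taken of the left-sided integral, as in the source, although the subscript
  minus usually denotes the right-sided operator.  The two are related by reflection, and the
  \<open>L\<^sup>2\<close> inner products of the images of the indicators of \<open>[0,t)\<close> are the same for both.\<close>

definition frac_deriv :: "real \<Rightarrow> (real \<Rightarrow> real) \<Rightarrow> real \<Rightarrow> real" where
  "frac_deriv r f x =
     1 / Gamma (1 - r) * deriv (\<lambda>y. LBINT t:{..<y}. f t * (y - t) powr (- r)) x"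

definition frac_integral :: "real \<Rightarrow> (real \<Rightarrow> real) \<Rightarrow> real \<Rightarrow> real" where
  "frac_integral r f x = 1 / Gamma r * (LBINT t:{x<..}. f t * (t - x) powr (r - 1))"

definition K_const :: "real \<Rightarrow> real" where
  "K_const \<alpha> = sqrt (\<alpha> * sin (\<alpha> * pi / 2) * Gamma \<alpha>)"

text \<open>\<open>M_minus \<alpha>\<close> is the operator \<open>M\<^sub>-\<close> with superscript \<open>\<alpha>/2\<close>.  The pointwise formulas
  make sense for indicator functions (off the two jump points), so no separate extension of the
  domain is needed.\<close>

definition M_minus :: "real \<Rightarrow> (real \<Rightarrow> real) \<Rightarrow> real \<Rightarrow> real" where
  "M_minus \<alpha> f x =
     (if \<alpha> < 1 then K_const \<alpha> * frac_deriv (- (\<alpha> - 1) / 2) f x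
      else if \<alpha> = 1 then f x
      else K_const \<alpha> * frac_integral ((\<alpha> - 1) / 2) f x)"

text \<open>Each \<open>B(t)\<close> is an element of \<open>L\<^sup>2(\<mu>)\<close>, so the process is only determined up to versions.
  Note \<open>\<langle>w\<^sub>j,\<eta>\<rangle> = \<langle>w, \<eta> e\<^sub>j\<rangle>\<^sub>0\<close>.\<close>

definition ggBm ::
  "real \<Rightarrow> 'd::finite functional_vec measure \<Rightarrow> (real \<Rightarrow> 'd functional_vec \<Rightarrow> real ^ 'd) \<Rightarrow> bool" where
  "ggBm \<alpha> \<mu> B \<longleftrightarrow>
     (\<forall>t\<ge>0. \<forall>j. L2_pairing \<mu> (\<lambda>x. axis j (M_minus \<alpha> (indicator {0..<t}) x)) (\<lambda>w. B t w $ j))"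

definition form_factor ::
  "'a measure \<Rightarrow> (real \<Rightarrow> 'a \<Rightarrow> real ^ 'd::finite) \<Rightarrow> nat \<Rightarrow> real ^ 'd \<Rightarrow> complex" where
  "form_factor \<mu> B n k = 1 / (of_nat n)\<^sup>2 *
     (LBINT t:{0..real n}. LBINT s:{0..real n}. LINT w|\<mu>. exp (\<i> * of_real (k \<bullet> (B t w - B s w))))"

text \<open>Below, the norm is the Euclidean norm of \<open>\<real>\<^sup>d\<close>, so the second moments
  sum over the \<open>d\<close> coordinates and carry a factor \<open>d\<close>, whereas the coefficient of
  \<open>|k|\<^sup>2\<close> in the form factor does not depend on \<open>d\<close>.\<close>

definition gyration_radius_sq ::
  "'a measure \<Rightarrow> (real \<Rightarrow> 'a \<Rightarrow> real ^ 'd::finite) \<Rightarrow> nat \<Rightarrow> real" where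
  "gyration_radius_sq \<mu> B n = 1 / 2 * (1 / (real n)\<^sup>2) *
     (LBINT t:{0..real n}. LBINT s:{0..real n}. LINT w|\<mu>. (norm (B t w - B s w))\<^sup>2)"

definition end_to_end_length_sq ::
  "'a measure \<Rightarrow> (real \<Rightarrow> 'a \<Rightarrow> real ^ 'd::finite) \<Rightarrow> nat \<Rightarrow> real" where
  "end_to_end_length_sq \<mu> B n = (LINT w|\<mu>. (norm (B (real n) w - B 0 w))\<^sup>2)"

end

theory Submission
  imports Defs "HOL-Real_Asymp.Real_Asymp"
begin

text \<open>
  The image of the indicator of \<open>[0,t)\<close> under \<open>M_minus \<alpha>\<close> is, up to a constant and almost everywhere,
  \<open>x\<^sub>+\<^sup>h - (x - t)\<^sub>+\<^sup>h\<close> with \<open>h = (\<alpha> - 1) / 2\<close> (or its reflection, for \<open>\<alpha> > 1\<close>).  By translation and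
  scaling the squared \<open>L\<^sup>2\<close> norm of the difference for \<open>s\<close> and \<open>t\<close> is a constant times \<open>|t - s|\<^sup>\<alpha>\<close>; the
  constant is the Mandelbrot--Van Ness integral, which has an explicit primitive up to an incomplete
  Beta function, and the reflection formula for Gamma shows that \<open>K_const\<close> normalises it to 1.

  The characteristic function of the pairing with a Schwartz function passes to the \<open>L\<^sup>2\<close> limit, so
  that \<open>k \<bullet> (B t - B s)\<close> has characteristic value \<open>E\<^sub>\<beta>(- |k|\<^sup>2 |t - s|\<^sup>\<alpha> / 2)\<close> for small \<open>k\<close>.
  Its second-order expansion at 0 gives the second moments and, being uniform
  in \<open>s, t \<in> [0,n]\<close>, also the expansion of the form factor.  Only small arguments of \<open>E\<^sub>\<beta>\<close> matter, so
  it suffices that its power series converges on the unit disc.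
\<close>

section \<open>The Mandelbrot--Van Ness integral\<close>

text \<open>The fundamental theorem of calculus at an interior point. The integrand may be unbounded
  at 0 and 1, so the argument rests on integrability over [0,1] and continuity at \<open>u\<close>
  alone.\<close>

lemma incomplete_Beta_deriv:
  fixes a b u :: real
  assumes "0 < a" "0 < b" "0 < u" "u < 1"
  shows "((\<lambda>u. integral {0..u} (\<lambda>t. t powr (a - 1) * (1 - t) powr (b - 1)))
            has_real_derivative u powr (a - 1) * (1 - u) powr (b - 1)) (at u)"
proof -
  let ?f = "\<lambda>t. t powr (a - 1) * (1 - t) powr (b - 1)"
  have int: "?f integrable_on {0..1}"
    using has_integral_Beta_real[OF assms(1,2)] by blast
  have "isCont ?f u"
    using assms by (intro continuous_intros) auto
  then have "((\<lambda>u. integral {0..u} ?f) has_vector_derivative ?f u) (at u within {0..1} - {})"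
    using assms by (intro integral_has_vector_derivative_continuous_at[OF int])
      (auto intro: continuous_at_imp_continuous_at_within)
  moreover have "at u within {0..1} = at u"
    using assms by (intro at_within_interior) (auto simp: interior_atLeastAtMost_real)
  ultimately show ?thesis
    by (simp add: has_real_derivative_iff_has_vector_derivative)
qed

text \<open>The single terms may grow like \<open>s powr (2*h+1)\<close>. With
  \<open>A = (1 + s) powr h\<close> and \<open>X = s powr h\<close> their sum equals
  \<open>s * (A - X)\<^sup>2 + A * (A - X) + A * X / (1 + s)\<close>. For \<open>s \<ge> 1\<close>
  the three summands are at most 1, 2 and 1 times \<open>s powr (2*h-1)\<close> in absolute value,
  and this exponent is negative.\<close>

lemma kernel_remainder_tendsto_0:
  fixes h :: real
  assumes h: "-1/2 < h" "h < 1/2"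
  shows "((\<lambda>s. (1 + s) powr (2*h+1) + s powr (2*h+1) - 2 * (s powr (h+1) * (1 + s) powr h)
              - s powr (h+1) * (1 + s) powr (h-1)) \<longlongrightarrow> 0) at_top"
    (is "(?f \<longlongrightarrow> 0) _")
proof (rule Lim_null_comparison)
  have "\<forall>\<^sub>F s::real in at_top. 1 \<le> s" by (rule eventually_ge_at_top)
  then show "\<forall>\<^sub>F s in at_top. norm (?f s) \<le> 4 * s powr (2*h-1)"
  proof eventually_elim
    case (elim s)
    then have s: "0 < s" by simp
    define A where "A = (1 + s) powr h"
    define X where "X = s powr h"
    have pw: "(1 + s) powr (2*h+1) = (1 + s) * A * A" "(1 + s) powr (h-1) = A / (1 + s)"
        "s powr (2*h+1) = s * X * X" "s powr (h+1) = s * X" "s powr (2*h-1) = X * X / s"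
        "s powr (h-1) = X / s"
      using s by (simp_all only: A_def X_def powr_add powr_diff mult_2 powr_one less_imp_le add_pos_pos zero_less_one)
        (simp_all add: mult_ac)
    have "?f s = s * (A - X)\<^sup>2 + A * (A - X) + A * X / (1 + s)"
      unfolding pw A_def[symmetric] using s by (simp add: power2_eq_square field_simps)
    \<comment> \<open>Mean value theorem on \<open>[s, 1 + s]\<close>: as \<open>h - 1\<close> is
      negative, \<open>z powr (h - 1)\<close> is at most its value at \<open>s\<close>, and
      \<open>\<bar>h\<bar> \<le> 1\<close>.\<close>
    moreover have AX: "\<bar>A - X\<bar> \<le> X / s"
    proof -
      obtain z where z: "z > s" "z < 1 + s"
          "(1 + s) powr h - s powr h = (1 + s - s) * (h * z powr (h - 1))"
        using MVT2[of s "1 + s" "\<lambda>z. z powr h" "\<lambda>z. h * z powr (h-1)"] s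
          has_real_derivative_powr[of _ h] by fastforce
      have "z powr (h-1) \<le> s powr (h-1)" using z s h by (intro powr_mono2') auto
      moreover have "\<bar>h\<bar> \<le> 1" using h by auto
      ultimately have "\<bar>h\<bar> * z powr (h-1) \<le> 1 * s powr (h-1)" by (intro mult_mono) auto
      then show ?thesis using z(3) by (simp add: A_def X_def pw(6)[unfolded X_def] abs_mult)
    qed
    moreover have A: "0 < A" "A \<le> 2 * X" "0 < X"
    proof -
      have "X / s \<le> X" using elim by (simp add: X_def field_simps mult_le_cancel_left1)
      then show "A \<le> 2 * X" using AX by linarith
    qed (use s in \<open>auto simp: A_def X_def\<close>)
    moreover have "s * (A - X)\<^sup>2 \<le> X * X / s"
    proof -
      have "(A - X)\<^sup>2 \<le> (X / s)\<^sup>2" using AX by (metis abs_ge_zero power2_abs power_mono)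
      then have "s * (A - X)\<^sup>2 \<le> s * (X / s)\<^sup>2" using s by simp
      then show ?thesis using s by (simp add: power2_eq_square)
    qed
    moreover have "\<bar>A * (A - X)\<bar> \<le> 2 * X * (X / s)"
      unfolding abs_mult using A AX by (intro mult_mono) auto
    moreover have "A * X / (1 + s) \<le> X * X / s"
    proof -
      have "A / (1 + s) \<le> X / s"
      proof -
        have "(1+s) powr (h-1) \<le> s powr (h-1)" using s h by (intro powr_mono2') auto
        then show ?thesis by (simp add: pw)
      qed
      then show ?thesis using mult_right_mono[of "A / (1+s)" "X / s" X] A by simp
    qed
    moreover have "0 \<le> s * (A - X)\<^sup>2" "0 \<le> A * X / (1 + s)" using s A by auto
    ultimately show ?case unfolding pw(5) real_norm_def by (simp add: abs_le_iff)
  qed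
  have "((\<lambda>s::real. s powr (2*h-1)) \<longlongrightarrow> 0) at_top"
    using h by (intro tendsto_neg_powr filterlim_ident) auto
  then show "((\<lambda>s. 4 * s powr (2*h-1)) \<longlongrightarrow> 0) at_top"
    using tendsto_mult_right_zero by blast
qed

text \<open>A primitive of \<open>((1 + s)\<^sup>h - s\<^sup>h)\<^sup>2\<close> is the elementary function \<open>G\<close> below, which vanishes at infinity,
  plus a multiple of the incomplete Beta integral \<open>P\<close> in the variable \<open>s / (1 + s)\<close>.\<close>

lemma powr_increment_square_integral:
  fixes h :: real
  assumes h: "-1/2 < h" "h < 1/2"
  defines "C \<equiv> (1 - h) / (2*h+1) * Beta (h+1) (1 - 2*h) - 1 / (2*h+1)"
  shows "set_integrable lborel {0<..} (\<lambda>s. ((1 + s) powr h - s powr h)\<^sup>2)" (is ?A)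
    and "(LBINT s:{0<..}. ((1 + s) powr h - s powr h)\<^sup>2) = C" (is ?B)
proof -
  define b where "b = (\<lambda>t::real. t powr (h + 1 - 1) * (1 - t) powr (1 - 2*h - 1))"
  define P where "P = (\<lambda>u. integral {0..u} b)"
  define c where "c = (1 - h) / (2*h+1)"
  define G where "G = (\<lambda>s. ((1 + s) powr (2*h+1) + s powr (2*h+1) - 2 * (s powr (h+1) * (1 + s) powr h)
              - s powr (h+1) * (1 + s) powr (h-1)) / (2*h+1))"
  define F where "F = (\<lambda>s. G s + c * P (s / (1 + s)))"
  define f where "f = (\<lambda>s::real. ((1 + s) powr h - s powr h)\<^sup>2)"
  have pos: "0 < 2*h+1" "0 < h + 1" "0 < 1 - 2*h" using h by auto
  have bint: "(b has_integral Beta (h+1) (1 - 2*h)) {0..1}"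
    unfolding b_def using pos by (intro has_integral_Beta_real) auto
  then have P1: "P 1 = Beta (h+1) (1 - 2*h)"
    by (simp add: P_def integral_unique)
  have Pcont: "continuous_on {0..1} P"
    unfolding P_def using bint by (intro indefinite_integral_continuous_1) blast
  have dF: "DERIV F s :> f s" if s: "0 < s" for s
  proof -
    have "s / (1 + s) < 1" "0 < s / (1 + s)" using s by auto
    then have "DERIV P (s/(1+s)) :> b (s/(1+s))"
      unfolding P_def b_def using pos by (intro incomplete_Beta_deriv) auto
    moreover have "DERIV (\<lambda>s. s/(1+s)) s :> 1 / (1+s)\<^sup>2"
      using s by (auto intro!: derivative_eq_intros simp: field_simps power2_eq_square)
    ultimately have dP: "DERIV (\<lambda>s. P (s/(1+s))) s :> b (s/(1+s)) * (1 / (1+s)\<^sup>2)"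
      by (rule DERIV_chain2)
    have sh: "1 - s/(1+s) = 1/(1+s)" using s by (simp add: field_simps)
    have N: "(1 + s) powr (- (2*h)) = 1 / ((1+s) powr h * (1+s) powr h)"
      by (simp only: powr_minus powr_add[symmetric] mult_2 inverse_eq_divide)
    \<comment> \<open>The exponents \<open>h\<close> and \<open>-2*h\<close> in \<open>b\<close> are
      chosen so that the chain rule yields exactly the cross term that the derivative of
      \<open>G\<close> leaves over.\<close>
    have bs: "b (s/(1+s)) * (1 / (1+s)\<^sup>2) = s powr h * (1+s) powr h / (1+s)\<^sup>2"
      unfolding b_def sh using s by (simp add: powr_divide N)
    define X where "X = s powr h"
    define Y where "Y = (1+s) powr h"
    have dG: "DERIV G s :> (((2*h+1) * Y\<^sup>2 + (2*h+1) * X\<^sup>2 - 2 * ((h+1) * X * Y + s * X * (h * Y / (1+s)))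
        - ((h+1) * X * (Y / (1+s)) + s * X * ((h-1) * Y / (1+s)\<^sup>2)))) / (2*h+1)"
    proof -
      have p: "(1+s) powr (2*h) = Y\<^sup>2" "s powr (2*h) = X\<^sup>2" "s powr (h+1) = s * X"
        "(1+s) powr (h-1) = Y / (1+s)" "(1+s) powr (h-1-1) = Y / (1+s)\<^sup>2"
        using s by (simp_all only: X_def Y_def powr_add powr_diff mult_2 power2_eq_square powr_one less_imp_le add_pos_pos zero_less_one)
          (simp_all add: mult_ac)
      have pd: "DERIV (\<lambda>s. s powr p) s :> p * s powr (p-1)"
          "DERIV (\<lambda>s. (1+s) powr p) s :> p * (1+s) powr (p-1)" for p
        using s by (auto intro!: derivative_eq_intros)
      show ?thesis
        unfolding G_def
        by (rule DERIV_cong, (rule pd DERIV_cdivide DERIV_diff DERIV_add DERIV_cmult DERIV_mult)+)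
          (use p pos in \<open>simp_all add: X_def[symmetric] Y_def[symmetric] mult_ac\<close>)
    qed
    have "DERIV F s :> (((2*h+1) * Y\<^sup>2 + (2*h+1) * X\<^sup>2 - 2 * ((h+1) * X * Y + s * X * (h * Y / (1+s)))
        - ((h+1) * X * (Y / (1+s)) + s * X * ((h-1) * Y / (1+s)\<^sup>2)))) / (2*h+1) + c * (X * Y / (1+s)\<^sup>2)"
      unfolding F_def using DERIV_add[OF dG DERIV_cmult[OF dP, of c]] unfolding bs X_def Y_def by simp
    also have "(((2*h+1) * Y\<^sup>2 + (2*h+1) * X\<^sup>2 - 2 * ((h+1) * X * Y + s * X * (h * Y / (1+s)))
        - ((h+1) * X * (Y / (1+s)) + s * X * ((h-1) * Y / (1+s)\<^sup>2)))) / (2*h+1) + c * (X * Y / (1+s)\<^sup>2)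
        = (Y - X)\<^sup>2"
    proof -
      \<comment> \<open>In terms of \<open>i\<close> the claim is a polynomial identity modulo the
        single relation \<open>s * i = 1 - i\<close>.\<close>
      define i where "i = 1 / (1 + s)"
      have i: "s * i = 1 - i" using s by (simp add: i_def field_simps)
      have d: "u / (1 + s) = u * i" "u / (1+s)\<^sup>2 = u * i * i" for u
        by (auto simp: i_def power2_eq_square)
      have "(2*h+1) * Y\<^sup>2 + (2*h+1) * X\<^sup>2 - 2 * ((h+1) * X * Y + s * X * (h * Y / (1+s)))
        - ((h+1) * X * (Y / (1+s)) + s * X * ((h-1) * Y / (1+s)\<^sup>2)) + (1 - h) * (X * Y / (1+s)\<^sup>2)
        = (2*h+1) * Y\<^sup>2 + (2*h+1) * X\<^sup>2 - 2 * ((h+1) * X * Y + (s * i) * X * (h * Y))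
        - ((h+1) * X * (Y * i) + (s * i) * X * ((h-1) * Y * i)) + (1 - h) * (X * Y * i * i)"
        unfolding d by (simp only: mult_ac)
      also have "\<dots> = (2*h+1) * (Y - X)\<^sup>2"
        unfolding i by (simp add: algebra_simps power2_eq_square)
      finally have K: "(2*h+1) * Y\<^sup>2 + (2*h+1) * X\<^sup>2 - 2 * ((h+1) * X * Y + s * X * (h * Y / (1+s)))
        - ((h+1) * X * (Y / (1+s)) + s * X * ((h-1) * Y / (1+s)\<^sup>2)) + (1 - h) * (X * Y / (1+s)\<^sup>2)
        = (2*h+1) * (Y - X)\<^sup>2" .
      have m: "u / (2*h+1) + (1 - h) / (2*h+1) * v = (u + (1 - h) * v) / (2*h+1)" for u v
        by (simp add: add_divide_distrib)
      show ?thesis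
        unfolding c_def m K using pos by simp
    qed
    finally show ?thesis by (simp add: f_def X_def Y_def)
  qed
  have cf: "isCont f s" if "0 < s" for s
    unfolding f_def using that by (intro continuous_intros) auto
  have ctn: "((\<lambda>s. P (s/(1+s))) \<longlongrightarrow> P 0) (at_right 0)"
  proof -
    have "(P \<longlongrightarrow> P 0) (at 0 within {0..1})" using Pcont by (auto simp: continuous_on_def)
    moreover have "filterlim (\<lambda>s::real. s/(1+s)) (at 0 within {0..1}) (at_right 0)"
      unfolding filterlim_at
      by (intro conjI; (real_asymp | (rule eventually_mono[OF eventually_at_right_less[of 0]], auto)))
    ultimately show ?thesis by (rule filterlim_compose)
  qed
  have cti: "((\<lambda>s. P (s/(1+s))) \<longlongrightarrow> P 1) at_top"
  proof -
    have "(P \<longlongrightarrow> P 1) (at 1 within {0..1})" using Pcont by (auto simp: continuous_on_def)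
    moreover have "filterlim (\<lambda>s::real. s/(1+s)) (at 1 within {0..1}) at_top"
      unfolding filterlim_at
      by (intro conjI; (real_asymp | (rule eventually_mono[OF eventually_gt_at_top[of 0]], auto)))
    ultimately show ?thesis by (rule filterlim_compose)
  qed
  \<comment> \<open>Only \<open>(1 + s) powr (2*h+1)\<close> survives at 0, since all powers of
    \<open>s\<close> have positive exponents. This limit is the term subtracted in
    \<open>C\<close>.\<close>
  have G0: "(G \<longlongrightarrow> 1 / (2*h+1)) (at_right 0)"
    unfolding G_def using pos by (real_asymp simp: inverse_eq_divide)
  have Gi: "(G \<longlongrightarrow> 0) at_top"
    unfolding G_def using tendsto_divide[OF kernel_remainder_tendsto_0[OF h] tendsto_const[of "2*h+1"]] pos by simp
  have F0: "((F \<circ> real_of_ereal) \<longlongrightarrow> 1 / (2*h+1)) (at_right (0::ereal))"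
    unfolding zero_ereal_def ereal_tendsto_simps F_def
    using tendsto_add[OF G0 tendsto_mult[OF tendsto_const[of c] ctn]] by (simp add: P_def)
  have Fi: "((F \<circ> real_of_ereal) \<longlongrightarrow> c * Beta (h+1) (1 - 2*h)) (at_left (\<infinity>::ereal))"
    unfolding ereal_tendsto_simps F_def
    using tendsto_add[OF Gi tendsto_mult[OF tendsto_const[of c] cti]] by (simp add: P1)
  \<comment> \<open>As \<open>f\<close> is nonnegative, finite limits of the primitive at both ends
    give integrability together with the value.\<close>
  note FTC = interval_integral_FTC_nonneg[of 0 \<infinity> F f, OF _ _ _ _ F0 Fi]
  have e: "einterval 0 \<infinity> = {0<..}" by (auto simp: einterval_def)
  show ?A using FTC(1) dF cf unfolding e by (simp add: f_def)
  have "(LBINT s=0..\<infinity>. f s) = c * Beta (h+1) (1 - 2*h) - 1 / (2*h+1)"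
    using dF cf by (intro FTC(2)) (auto simp: f_def)
  then show ?B
    unfolding interval_lebesgue_integral_def e by (simp add: f_def C_def c_def)
qed

text \<open>The positive-part power: \<^const>\<open>powr\<close> itself is not zero at negative arguments.\<close>

definition ppow :: "real \<Rightarrow> real \<Rightarrow> real" where
  "ppow p x = (if 0 < x then x powr p else 0)"

lemma ppow_measurable [measurable]: "ppow p \<in> borel_measurable borel"
  unfolding ppow_def by measurable

text \<open>The integrand lives on (0,b), where the primitive
  \<open>x powr (p + 1) / (p + 1)\<close> tends to 0 at 0 because \<open>p + 1\<close> is positive.
  Writing the value with \<open>ppow\<close> also covers \<open>b \<le> 0\<close>.\<close>

lemma ppow_Iic_integral:
  assumes p: "-1 < p"
  shows "has_bochner_integral lborel (\<lambda>x. indicator {..b} x * ppow p x) (ppow (p + 1) b / (p + 1))"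
proof (cases "0 < b")
  case False
  then have "(\<lambda>x. indicator {..b} x * ppow p x) = (\<lambda>x. 0)"
    by (auto simp: indicator_def ppow_def)
  then show ?thesis using False by (simp add: ppow_def has_bochner_integral_zero)
next
  case True
  let ?F = "\<lambda>x. x powr (p + 1) / (p + 1)"
  let ?f = "\<lambda>x::real. x powr p"
  have F0: "((?F \<circ> real_of_ereal) \<longlongrightarrow> 0) (at_right (ereal 0))"
    unfolding ereal_tendsto_simps using p
    by (auto intro!: tendsto_eq_intros tendsto_zero_powrI[where b="p+1"] eventually_mono[OF eventually_at_right_less[of 0]])
  have Fb: "((?F \<circ> real_of_ereal) \<longlongrightarrow> b powr (p + 1) / (p + 1)) (at_left (ereal b))"
    unfolding ereal_tendsto_simps using p True by (auto intro!: tendsto_eq_intros)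
  have d: "DERIV ?F x :> ?f x" if "0 < x" for x
    using that p by (auto intro!: derivative_eq_intros)
  have c: "isCont ?f x" if "0 < x" for x
    using that by (intro continuous_intros) auto
  note FTC = interval_integral_FTC_nonneg[of "ereal 0" "ereal b" ?F ?f, OF _ _ _ _ F0 Fb]
  have e: "einterval (ereal 0) (ereal b) = {0<..<b}" by (auto simp: einterval_def)
  have 1: "set_integrable lborel {0<..<b} ?f" using FTC(1) d c True unfolding e by simp
  have "(LBINT x=ereal 0..ereal b. ?f x) = b powr (p + 1) / (p + 1) - 0"
    using d c True by (intro FTC(2)) auto
  then have 2: "(LBINT x:{0<..<b}. ?f x) = b powr (p + 1) / (p + 1)"
    using True unfolding interval_lebesgue_integral_def e by simp
  have ae: "AE x in lborel. indicator {0<..<b} x *\<^sub>R x powr p = indicator {..b} x * ppow p x"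
    using AE_lborel_singleton[of b]
    by eventually_elim (auto simp: indicator_def ppow_def)
  have "has_bochner_integral lborel (\<lambda>x. indicator {0<..<b} x *\<^sub>R x powr p) (b powr (p + 1) / (p + 1))"
    using 1 2 unfolding set_integrable_def set_lebesgue_integral_def has_bochner_integral_iff by simp
  also have "?this \<longleftrightarrow> ?thesis"
    using True by (subst has_bochner_integral_cong_AE[OF _ _ ae]) (auto simp: ppow_def)
  finally show ?thesis .
qed

lemma ppow_Icc_integral:
  assumes "-1 < p" "a \<le> b"
  shows "has_bochner_integral lborel (\<lambda>x. indicator {a..b} x * ppow p x)
           ((ppow (p + 1) b - ppow (p + 1) a) / (p + 1))"
proof -
  have ae: "AE x in lborel. indicator {..b} x * ppow p x - indicator {..a} x * ppow p x
      = indicator {a..b} x * ppow p x"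
    using AE_lborel_singleton[of a]
    by eventually_elim (use assms in \<open>auto simp: indicator_def\<close>)
  have "has_bochner_integral lborel (\<lambda>x. indicator {..b} x * ppow p x - indicator {..a} x * ppow p x)
      (ppow (p + 1) b / (p + 1) - ppow (p + 1) a / (p + 1))"
    using assms by (intro has_bochner_integral_diff ppow_Iic_integral)
  then show ?thesis
    by (subst has_bochner_integral_cong_AE[OF _ _ ae, symmetric]) (auto simp: diff_divide_distrib)
qed

text \<open>The Mandelbrot--Van Ness constant in closed form: the integral over the whole line of
  the squared kernel of a unit time step.\<close>

definition kernel_const :: "real \<Rightarrow> real" where
  "kernel_const h = (1 - h) / (2*h+1) * Beta (h+1) (1 - 2*h)"

text \<open>The integral is split at 1. Beyond 1 the substitution \<open>x = 1 + s\<close> gives the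
  half-line integral computed above; on (0,1] only \<open>x powr h\<close> is present, and its
  square contributes \<open>1 / (2*h+1)\<close>, cancelling the subtracted term there.\<close>

lemma kernel_square_integral_unit:
  assumes h: "-1/2 < h" "h < 1/2"
  shows "has_bochner_integral lborel (\<lambda>x. (ppow h x - ppow h (x - 1))\<^sup>2) (kernel_const h)"
proof -
  let ?g = "\<lambda>s. indicator {0<..} s *\<^sub>R ((1 + s) powr h - s powr h)\<^sup>2"
  have "has_bochner_integral lborel ?g (kernel_const h - 1 / (2*h+1))"
    using powr_increment_square_integral[OF h]
    unfolding set_integrable_def set_lebesgue_integral_def has_bochner_integral_iff kernel_const_def
    by simp
  then have "has_bochner_integral lborel (\<lambda>x. ?g (-1 + 1 * x)) ((kernel_const h - 1 / (2*h+1)) /\<^sub>R \<bar>1\<bar>)"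
    by (subst (asm) lborel_has_bochner_integral_real_affine_iff[of 1 _ _ "-1"]) auto
  moreover have "has_bochner_integral lborel (\<lambda>x. indicator {..1} x * ppow (2*h) x) (ppow (2*h+1) 1 / (2*h+1))"
    using h by (intro ppow_Iic_integral) auto
  ultimately have "has_bochner_integral lborel (\<lambda>x. ?g (-1 + 1 * x) + indicator {..1} x * ppow (2*h) x)
     ((kernel_const h - 1 / (2*h+1)) /\<^sub>R \<bar>1\<bar> + ppow (2*h+1) 1 / (2*h+1))"
    by (rule has_bochner_integral_add)
  moreover have "(\<lambda>x. ?g (-1 + 1 * x) + indicator {..1} x * ppow (2*h) x) = (\<lambda>x. (ppow h x - ppow h (x - 1))\<^sup>2)"
  proof
    fix x :: real
    have "x powr (2*h) = (x powr h)\<^sup>2" by (simp only: mult_2 powr_add power2_eq_square)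
    then show "?g (-1 + 1 * x) + indicator {..1} x * ppow (2*h) x = (ppow h x - ppow h (x - 1))\<^sup>2"
      by (auto simp: ppow_def indicator_def)
  qed
  ultimately show ?thesis by (simp add: ppow_def)
qed

text \<open>With \<open>L = t - s\<close> and the variable \<open>(x - s) / L\<close>, homogeneity
  of \<open>ppow h\<close> gives a factor \<open>L powr (2*h)\<close> and the change of measure one
  more \<open>L\<close>. The second formula is the first after the reflection of \<open>x\<close> to
  \<open>s + t - x\<close>.\<close>

lemma kernel_square_integral:
  assumes h: "-1/2 < h" "h < 1/2" and st: "s \<le> t"
  shows "has_bochner_integral lborel (\<lambda>x. (ppow h (x - s) - ppow h (x - t))\<^sup>2)
           ((t - s) powr (2*h+1) * kernel_const h)" (is ?A)
    and "has_bochner_integral lborel (\<lambda>x. (ppow h (t - x) - ppow h (s - x))\<^sup>2)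
           ((t - s) powr (2*h+1) * kernel_const h)" (is ?B)
proof -
  show A: ?A
  proof (cases "s = t")
    case False
    define L where "L = t - s"
    have L: "0 < L" using False st by (simp add: L_def)
    have t: "t = s + L" by (simp add: L_def)
    let ?k = "\<lambda>x. (ppow h x - ppow h (x - 1))\<^sup>2"
    have "has_bochner_integral lborel (\<lambda>x. ?k (- s / L + (1 / L) * x)) (kernel_const h /\<^sub>R \<bar>1 / L\<bar>)"
      using kernel_square_integral_unit[OF h] L
      by (subst (asm) lborel_has_bochner_integral_real_affine_iff[of "1 / L" _ _ "- s / L"]) auto
    then have "has_bochner_integral lborel (\<lambda>x. L powr (2*h) * ?k (- s / L + (1 / L) * x))
        (L powr (2*h) * (kernel_const h /\<^sub>R \<bar>1 / L\<bar>))"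
      by (rule has_bochner_integral_mult_right)
    moreover have "L powr (2*h) * (kernel_const h /\<^sub>R \<bar>1 / L\<bar>) = (t - s) powr (2*h+1) * kernel_const h"
      using L by (simp add: powr_add flip: L_def)
    moreover have "L powr (2*h) * ?k (- s / L + (1 / L) * x) = (ppow h (x - s) - ppow h (x - t))\<^sup>2" for x
    proof -
      have sc: "ppow h (y / L) * L powr h = ppow h y" for y
        using L by (auto simp: ppow_def powr_divide zero_less_divide_iff)
      have e: "- s / L + (1 / L) * x = (x - s) / L" "(x - s) / L - 1 = (x - t) / L"
        using L by (auto simp: diff_divide_distrib add_divide_distrib t)
      have "L powr (2*h) = (L powr h)\<^sup>2" by (simp only: mult_2 powr_add power2_eq_square)
      then have "L powr (2*h) * ?k (- s / L + (1 / L) * x)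
          = (ppow h ((x - s) / L) * L powr h - ppow h ((x - t) / L) * L powr h)\<^sup>2"
        unfolding e by (simp add: power_mult_distrib flip: left_diff_distrib)
      then show ?thesis unfolding sc .
    qed
    ultimately show ?thesis by (simp only:)
  qed (simp add: has_bochner_integral_zero)
  show ?B
    using A by (subst (asm) lborel_has_bochner_integral_real_affine_iff[of "-1" _ _ "s + t"]) (auto simp: algebra_simps)
qed

section \<open>Evaluation of the constant by the reflection formula\<close>

lemma Gamma_reflection_real: "Gamma x * Gamma (1 - x) = pi / sin (pi * x)" for x :: real
proof -
  have "Gamma (complex_of_real x) * Gamma (complex_of_real (1 - x))
      = of_real pi / sin (complex_of_real (pi * x))"
    using Gamma_reflection_complex[of "of_real x"] by simp
  then have "complex_of_real (Gamma x * Gamma (1 - x)) = complex_of_real (pi / sin (pi * x))"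
    unfolding Gamma_complex_of_real sin_of_real by simp
  then show ?thesis by (simp only: of_real_eq_iff)
qed

lemma Gamma_plus1_minus_real:
  fixes x :: real
  assumes "x \<notin> \<int>"
  shows "Gamma (x + 1) * Gamma (1 - x) = pi * x / sin (pi * x)"
proof -
  have "x \<notin> \<int>\<^sub>\<le>\<^sub>0" using assms nonpos_Ints_subset_Ints by blast
  then show ?thesis using Gamma_reflection_real[of x] by (simp add: Gamma_plus1 mult_ac)
qed

text \<open>Writing Beta by Gamma values and cancelling \<open>1 - h\<close> against
  \<open>Gamma (2 - h)\<close> leaves \<open>Gamma (1 - 2*h)\<close> and
  \<open>Gamma (1 - h)\<close>. Reflection at \<open>2*h\<close> and at \<open>h\<close> removes
  both; the sine is \<open>cos (pi * h)\<close>, which cancels through the double angle formula. The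
  case \<open>h = 0\<close> is separate because the reflection formula divides by
  \<open>sin (pi * h)\<close>.\<close>

lemma kernel_const_eq:
  assumes h: "-1/2 < h" "h < 1/2"
  shows "kernel_const h * ((2*h+1) * sin ((2*h+1) * pi / 2) * Gamma (2*h+1)) = (Gamma (h+1))\<^sup>2"
proof (cases "h = 0")
  case True
  have "Gamma (2::real) = 1" using Gamma_fact[of 1, where 'a=real] by simp
  then have "kernel_const 0 = 1" unfolding kernel_const_def Beta_def by simp
  then show ?thesis using True by simp
next
  case False
  have G: "Gamma (h+1) > 0" "Gamma (1-h) > 0" "Gamma (1-2*h) > 0" "Gamma (2*h+1) > 0"
    using h by (auto intro!: Gamma_real_pos)
  have s: "sin ((2*h+1) * pi / 2) = cos (pi * h)"
    by (simp add: sin_cos_eq field_simps)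
  have nI2: "2*h \<notin> \<int>"
  proof
    assume "2*h \<in> \<int>"
    then obtain z where z: "2*h = of_int z" by (auto elim: Ints_cases)
    then have "-1 < z" "z < 1" using h by linarith+
    then show False using z False by simp
  qed
  then have nI: "h \<notin> \<int>" by auto
  have ch: "cos (pi * h) \<noteq> 0"
  proof -
    have "pi * (-1/2) < pi * h" "pi * h < pi * (1/2)"
      using h by (intro mult_strict_left_mono; simp)+
    then have "0 < cos (pi * h)" by (intro cos_gt_zero_pi) auto
    then show ?thesis by simp
  qed
  have "Gamma (2*h+1) * Gamma (1-2*h) = pi * (2*h) / (2 * sin (pi * h) * cos (pi * h))"
    using Gamma_plus1_minus_real[OF nI2] sin_double[of "pi * h"] by (simp add: mult_ac)
  then have g2: "Gamma (2*h+1) * Gamma (1-2*h) * cos (pi * h) = pi * h / sin (pi * h)"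
    using ch by simp
  have g3: "Gamma (1 - h + 1) = (1 - h) * Gamma (1 - h)"
    using h by (intro Gamma_plus1) (auto elim!: nonpos_Ints_cases)
  have "h + 1 + (1 - 2*h) = 1 - h + 1" by simp
  then have "kernel_const h = (1 - h) / (2*h+1) * (Gamma (h+1) * Gamma (1-2*h) / ((1 - h) * Gamma (1 - h)))"
    unfolding kernel_const_def Beta_def g3[symmetric] by simp
  also have "\<dots> = Gamma (h+1) * Gamma (1-2*h) / ((2*h+1) * Gamma (1 - h))"
    using h by simp
  finally have "kernel_const h * ((2*h+1) * cos (pi * h) * Gamma (2*h+1))
     = Gamma (h+1) * (Gamma (2*h+1) * Gamma (1-2*h) * cos (pi * h)) / Gamma (1 - h)"
    using h by (simp add: mult_ac)
  also have "\<dots> = Gamma (h+1) * (Gamma (h+1) * Gamma (1 - h)) / Gamma (1 - h)"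
    unfolding g2 Gamma_plus1_minus_real[OF nI] ..
  also have "\<dots> = (Gamma (h+1))\<^sup>2" using G by (simp add: power2_eq_square)
  finally show ?thesis unfolding s .
qed

section \<open>Fractional operators on indicator functions\<close>

lemma ppow_deriv:
  assumes "x \<noteq> 0"
  shows "DERIV (ppow p) x :> p * ppow (p - 1) x"
proof (cases "0 < x")
  case True
  have d: "DERIV (\<lambda>x. x powr p) x :> p * ppow (p - 1) x"
    using True by (auto intro!: derivative_eq_intros simp: ppow_def)
  have "\<forall>\<^sub>F y in nhds x. y \<in> {0<..}"
    using True by (intro eventually_nhds_in_open) auto
  then have e: "\<forall>\<^sub>F y in nhds x. y powr p = ppow p y"
    by eventually_elim (simp add: ppow_def)
  show ?thesis
    by (rule iffD1[OF DERIV_cong_ev[OF refl e refl] d])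
next
  case False
  then have x: "x < 0" using assms by simp
  have d: "DERIV (\<lambda>x. 0) x :> p * ppow (p - 1) x"
    using x by (simp add: ppow_def)
  have "\<forall>\<^sub>F y in nhds x. y \<in> {..<0}"
    using x by (intro eventually_nhds_in_open) auto
  then have e: "\<forall>\<^sub>F y in nhds x. 0 = ppow p y"
    by eventually_elim (simp add: ppow_def)
  show ?thesis
    by (rule iffD1[OF DERIV_cong_ev[OF refl e refl] d])
qed

text \<open>The inner integral is found in closed form for every upper limit \<open>y\<close>, after
  which it can be differentiated at \<open>x\<close>. The two excluded points are those where a
  summand of the primitive may fail to be differentiable.\<close>

lemma frac_deriv_indicator:
  assumes r: "r < 1" and t: "0 \<le> t" and x: "x \<noteq> 0" "x \<noteq> t"
  shows "frac_deriv r (indicator {0..<t}) x = (ppow (- r) x - ppow (- r) (x - t)) / Gamma (1 - r)"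
proof -
  have inner: "(LBINT u:{..<y}. indicator {0..<t} u * (y - u) powr (- r))
      = (ppow (1 - r) y - ppow (1 - r) (y - t)) / (1 - r)" for y
  proof -
    let ?f = "\<lambda>u. indicat_real {..<y} u *\<^sub>R (indicator {0..<t} u * (y - u) powr (- r))"
    have "has_bochner_integral lborel (\<lambda>v. indicator {y - t..y} v * ppow (- r) v)
        ((ppow (- r + 1) y - ppow (- r + 1) (y - t)) / (- r + 1))"
      using r t by (intro ppow_Icc_integral) auto
    \<comment> \<open>After the substitution \<open>u = y - v\<close> the two sides can differ only
      at \<open>v = y - t\<close>, that is at \<open>u = t\<close>, which the half-open interval
      omits.\<close>
    moreover have ae: "AE v in lborel. indicator {y - t..y} v * ppow (- r) v = ?f (y + -1 * v)"
      using AE_lborel_singleton[of "y - t"]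
      by eventually_elim (auto simp: indicator_def ppow_def)
    ultimately have "has_bochner_integral lborel (\<lambda>v. ?f (y + -1 * v))
        ((ppow (- r + 1) y - ppow (- r + 1) (y - t)) / (- r + 1))"
      by (subst (asm) has_bochner_integral_cong_AE[OF _ _ ae]) auto
    then have "has_bochner_integral lborel ?f ((ppow (- r + 1) y - ppow (- r + 1) (y - t)) / (- r + 1))"
      by (subst lborel_has_bochner_integral_real_affine_iff[of "-1" _ _ y]) auto
    then show ?thesis
      by (simp add: set_lebesgue_integral_def has_bochner_integral_integral_eq)
  qed
  have "DERIV (\<lambda>y. ppow (1 - r) (y - t)) x :> (1 - r) * ppow (1 - r - 1) (x - t)"
    using DERIV_shift[of "ppow (1 - r)" _ x "- t"] ppow_deriv[of "x - t" "1 - r"] x by simp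
  then have "DERIV (\<lambda>y. (ppow (1 - r) y - ppow (1 - r) (y - t)) / (1 - r)) x :>
     ((1 - r) * ppow (1 - r - 1) x - (1 - r) * ppow (1 - r - 1) (x - t)) / (1 - r)"
    by (intro DERIV_cdivide DERIV_diff ppow_deriv x)
  then have "deriv (\<lambda>y. (ppow (1 - r) y - ppow (1 - r) (y - t)) / (1 - r)) x = ppow (- r) x - ppow (- r) (x - t)"
    using r by (subst DERIV_imp_deriv) (auto simp flip: right_diff_distrib)
  then show ?thesis
    unfolding frac_deriv_def inner by simp
qed

lemma frac_integral_indicator:
  assumes r: "0 < r" and t: "0 \<le> t"
  shows "frac_integral r (indicator {0..<t}) x = (ppow r (t - x) - ppow r (- x)) / Gamma (r + 1)"
proof -
  let ?f = "\<lambda>u. indicat_real {x<..} u *\<^sub>R (indicator {0..<t} u * (u - x) powr (r - 1))"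
  have "has_bochner_integral lborel (\<lambda>v. indicator {- x..t - x} v * ppow (r - 1) v)
      ((ppow (r - 1 + 1) (t - x) - ppow (r - 1 + 1) (- x)) / (r - 1 + 1))"
    using r t by (intro ppow_Icc_integral) auto
  moreover have ae: "AE v in lborel. indicator {- x..t - x} v * ppow (r - 1) v = ?f (x + 1 * v)"
    using AE_lborel_singleton[of "t - x"]
    by eventually_elim (auto simp: indicator_def ppow_def)
  ultimately have "has_bochner_integral lborel (\<lambda>v. ?f (x + 1 * v))
      ((ppow (r - 1 + 1) (t - x) - ppow (r - 1 + 1) (- x)) / (r - 1 + 1))"
    by (subst (asm) has_bochner_integral_cong_AE[OF _ _ ae]) auto
  then have "has_bochner_integral lborel ?f ((ppow r (t - x) - ppow r (- x)) / r)"
    by (subst lborel_has_bochner_integral_real_affine_iff[of 1 _ _ x]) auto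
  then have "(LBINT u:{x<..}. indicator {0..<t} u * (u - x) powr (r - 1)) = (ppow r (t - x) - ppow r (- x)) / r"
    by (simp add: set_lebesgue_integral_def has_bochner_integral_integral_eq)
  moreover have "Gamma (r + 1) = r * Gamma r"
    using r by (intro Gamma_plus1) (auto elim!: nonpos_Ints_cases)
  ultimately show ?thesis
    unfolding frac_integral_def by simp
qed

text \<open>Two shapes occur because a left-sided derivative defines the operator for
  \<open>\<alpha> < 1\<close> and a right-sided integral for \<open>\<alpha> > 1\<close>. At
  \<open>\<alpha> = 1\<close> one has \<open>c = 1\<close> and \<open>h = 0\<close>, and the
  difference of the two step functions is the indicator off the endpoints.\<close>

lemma M_minus_indicator_AE:
  assumes \<alpha>: "0 < \<alpha>" "\<alpha> < 2" and t: "0 \<le> t"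
  defines "h \<equiv> (\<alpha> - 1) / 2"
  defines "c \<equiv> K_const \<alpha> / Gamma (h + 1)"
  shows "\<alpha> \<le> 1 \<Longrightarrow> AE x in lborel. M_minus \<alpha> (indicator {0..<t}) x = c * (ppow h x - ppow h (x - t))"
    and "1 < \<alpha> \<Longrightarrow> AE x in lborel. M_minus \<alpha> (indicator {0..<t}) x = c * (ppow h (t - x) - ppow h (- x))"
proof -
  have ne: "AE x in lborel. x \<noteq> 0 \<and> x \<noteq> t"
    using AE_lborel_singleton[of 0] AE_lborel_singleton[of t] by auto
  show "AE x in lborel. M_minus \<alpha> (indicator {0..<t}) x = c * (ppow h x - ppow h (x - t))" if "\<alpha> \<le> 1"
  proof (cases "\<alpha> = 1")
    case True
    then have "c = 1" "h = 0" by (simp_all add: c_def h_def K_const_def)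
    note c1h0 = this
    from ne show ?thesis
      by eventually_elim (use t in \<open>auto simp: c1h0 True M_minus_def ppow_def indicator_def\<close>)
  next
    case False
    then have a1: "\<alpha> < 1" "- h < 1" "- (\<alpha> - 1) / 2 = - h" "1 - (- h) = h + 1"
      using that \<alpha> by (auto simp: h_def field_simps)
    from ne show ?thesis
    proof eventually_elim
      case (elim x)
      then have x: "x \<noteq> 0" "x \<noteq> t" by auto
      have "frac_deriv (- h) (indicator {0..<t}) x = (ppow h x - ppow h (x - t)) / Gamma (h + 1)"
        using frac_deriv_indicator[OF a1(2) t x] unfolding a1(4) minus_minus .
      then show ?case
        by (simp only: M_minus_def a1(1,3) if_True c_def) simp
    qed
  qed
  show "AE x in lborel. M_minus \<alpha> (indicator {0..<t}) x = c * (ppow h (t - x) - ppow h (- x))" if "1 < \<alpha>"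
    using that frac_integral_indicator[OF _ t, of h] by (auto simp: M_minus_def c_def h_def)
qed

text \<open>This is \<open>kernel_const_eq\<close> with \<open>2*h+1 = \<alpha>\<close>. The sine is
  positive for \<open>0 < \<alpha> < 2\<close>, so the square root in \<open>K_const\<close> squares
  back to its argument.\<close>

lemma K_const_sq:
  assumes \<alpha>: "0 < \<alpha>" "\<alpha> < 2"
  defines "h \<equiv> (\<alpha> - 1) / 2"
  shows "(K_const \<alpha> / Gamma (h + 1))\<^sup>2 * kernel_const h = 1"
proof -
  have h: "-1/2 < h" "h < 1/2" "2*h+1 = \<alpha>" using \<alpha> by (auto simp: h_def field_simps)
  have "0 < sin (\<alpha> * pi / 2)" using \<alpha> by (intro sin_gt_zero) auto
  then have "(K_const \<alpha>)\<^sup>2 = \<alpha> * sin (\<alpha> * pi / 2) * Gamma \<alpha>"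
    unfolding K_const_def using \<alpha> Gamma_real_pos[of \<alpha>] by (intro real_sqrt_pow2) simp
  moreover have "Gamma (h + 1) > 0" using h by (intro Gamma_real_pos) auto
  ultimately show ?thesis
    using kernel_const_eq[OF h(1,2)] unfolding h(3) by (simp add: power_divide field_simps)
qed

text \<open>The summand belonging to time 0 cancels in the difference, leaving the kernel for
  \<open>s\<close> and \<open>t\<close>; by symmetry \<open>s \<le> t\<close> may be assumed.
  Measurability is a hypothesis because the operator is identified only almost everywhere; for the
  process it comes with \<open>L2_pairing\<close>.\<close>

lemma M_minus_increment:
  assumes \<alpha>: "0 < \<alpha>" "\<alpha> < 2" and st: "0 \<le> s" "0 \<le> t"
    and [measurable]: "M_minus \<alpha> (indicator {0..<t}) \<in> borel_measurable borel"
      "M_minus \<alpha> (indicator {0..<s}) \<in> borel_measurable borel"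
  shows "has_bochner_integral lborel
     (\<lambda>x. (M_minus \<alpha> (indicator {0..<t}) x - M_minus \<alpha> (indicator {0..<s}) x)\<^sup>2) (\<bar>t - s\<bar> powr \<alpha>)"
  using st assms(5,6)
proof (induction s t rule: linorder_wlog)
  case (le s t)
  note [measurable] = le(4,5)
  define h where "h = (\<alpha> - 1) / 2"
  define c where "c = K_const \<alpha> / Gamma (h + 1)"
  have h: "-1/2 < h" "h < 1/2" "2*h+1 = \<alpha>" using \<alpha> by (auto simp: h_def field_simps)
  have ck: "c\<^sup>2 * (\<bar>t - s\<bar> powr \<alpha> * kernel_const h) = \<bar>t - s\<bar> powr \<alpha>"
    using K_const_sq[OF \<alpha>] by (simp add: c_def h_def mult_ac)
  have sq: "c\<^sup>2 * (b - d)\<^sup>2 = (c * (a - d) - c * (a - b))\<^sup>2"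
      "c\<^sup>2 * (b - d)\<^sup>2 = (c * (b - a) - c * (d - a))\<^sup>2" for a b d
    by (simp_all add: algebra_simps power2_eq_square)
  have ab: "\<bar>t - s\<bar> = t - s" using le(1) by simp
  note kern = kernel_square_integral[OF h(1,2) le(1), unfolded h(3)]
  note ae = M_minus_indicator_AE[OF \<alpha>, folded h_def, folded c_def]
  show ?case
  proof (cases "\<alpha> \<le> 1")
    case True
    have "AE x in lborel. c\<^sup>2 * (ppow h (x - s) - ppow h (x - t))\<^sup>2
        = (M_minus \<alpha> (indicator {0..<t}) x - M_minus \<alpha> (indicator {0..<s}) x)\<^sup>2"
      using ae(1)[OF le(2) True] ae(1)[OF le(3) True]
      by eventually_elim (simp only: , rule sq(1))
    moreover have "has_bochner_integral lborel (\<lambda>x. c\<^sup>2 * (ppow h (x - s) - ppow h (x - t))\<^sup>2) (\<bar>t - s\<bar> powr \<alpha>)"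
      using has_bochner_integral_mult_right[OF kern(1), of "c\<^sup>2"] unfolding ck[unfolded ab] ab .
    ultimately show ?thesis
      by (subst has_bochner_integral_cong_AE[symmetric]) auto
  next
    case False
    then have False: "1 < \<alpha>" by simp
    have "AE x in lborel. c\<^sup>2 * (ppow h (t - x) - ppow h (s - x))\<^sup>2
        = (M_minus \<alpha> (indicator {0..<t}) x - M_minus \<alpha> (indicator {0..<s}) x)\<^sup>2"
      using ae(2)[OF le(2) False] ae(2)[OF le(3) False]
      by eventually_elim (simp only: , rule sq(2))
    moreover have "has_bochner_integral lborel (\<lambda>x. c\<^sup>2 * (ppow h (t - x) - ppow h (s - x))\<^sup>2) (\<bar>t - s\<bar> powr \<alpha>)"
      using has_bochner_integral_mult_right[OF kern(2), of "c\<^sup>2"] unfolding ck[unfolded ab] ab .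
    ultimately show ?thesis
      by (subst has_bochner_integral_cong_AE[symmetric]) auto
  qed
next
  case (sym s t)
  then show ?case by (simp add: power2_commute abs_minus_commute)
qed

text \<open>Applies to the indicator of the empty interval [0,0), so that the image at time
  \<open>t\<close> counts as an increment from time 0.\<close>

lemma M_minus_zero: "M_minus \<alpha> (\<lambda>x. 0) = (\<lambda>x. 0)"
  by (simp add: fun_eq_iff M_minus_def frac_deriv_def frac_integral_def set_lebesgue_integral_def)

section \<open>Integrals over a square\<close>

lemma ppow_shift_integral:
  assumes "-1 < p" "a \<le> b"
  shows "has_bochner_integral lborel (\<lambda>s. indicator {a..b} s * ppow p (s - c))
           ((ppow (p + 1) (b - c) - ppow (p + 1) (a - c)) / (p + 1))" (is ?A)
    and "has_bochner_integral lborel (\<lambda>s. indicator {a..b} s * ppow p (c - s))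
           ((ppow (p + 1) (c - a) - ppow (p + 1) (c - b)) / (p + 1))" (is ?B)
proof -
  have "(\<lambda>v. indicator {a - c..b - c} v * ppow p v) = (\<lambda>v. indicator {a..b} (c + 1 * v) * ppow p ((c + 1 * v) - c))"
    by (auto simp: fun_eq_iff indicator_def)
  then show ?A
    using ppow_Icc_integral[of p "a - c" "b - c"] assms
    by (subst lborel_has_bochner_integral_real_affine_iff[of 1 _ _ c]) auto
  have "(\<lambda>v. indicator {c - b..c - a} v * ppow p v) = (\<lambda>v. indicator {a..b} (c + -1 * v) * ppow p (c - (c + -1 * v)))"
    by (auto simp: fun_eq_iff indicator_def)
  then show ?B
    using ppow_Icc_integral[of p "c - b" "c - a"] assms
    by (subst lborel_has_bochner_integral_real_affine_iff[of "-1" _ _ c]) auto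
qed

text \<open>Splitting \<open>\<bar>x\<bar> powr \<alpha>\<close> into the positive-part powers of
  \<open>x\<close> and \<open>- x\<close> reduces both integrations to the primitive of
  \<open>ppow\<close>.\<close>

lemma abs_powr_diff_double_integral:
  fixes \<alpha> N :: real
  assumes \<alpha>: "0 < \<alpha>" and N: "0 \<le> N"
  shows "(LBINT t:{0..N}. LBINT s:{0..N}. \<bar>t - s\<bar> powr \<alpha>) = 2 * N powr (\<alpha> + 2) / ((\<alpha> + 1) * (\<alpha> + 2))"
proof -
  have abs: "\<bar>x\<bar> powr \<alpha> = ppow \<alpha> x + ppow \<alpha> (- x)" for x
    by (auto simp: ppow_def)
  have inner: "(LBINT s:{0..N}. \<bar>t - s\<bar> powr \<alpha>) = (ppow (\<alpha> + 1) t + ppow (\<alpha> + 1) (N - t)) / (\<alpha> + 1)"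
    if t: "t \<in> {0..N}" for t
  proof -
    have "has_bochner_integral lborel (\<lambda>s. indicator {0..N} s * ppow \<alpha> (t - s) + indicator {0..N} s * ppow \<alpha> (s - t))
      ((ppow (\<alpha> + 1) (t - 0) - ppow (\<alpha> + 1) (t - N)) / (\<alpha> + 1)
        + (ppow (\<alpha> + 1) (N - t) - ppow (\<alpha> + 1) (0 - t)) / (\<alpha> + 1))"
      using \<alpha> N by (intro has_bochner_integral_add ppow_shift_integral) auto
    then show ?thesis
      using t by (simp add: set_lebesgue_integral_def abs distrib_left has_bochner_integral_integral_eq ppow_def
          add_divide_distrib)
  qed
  have "(LBINT t:{0..N}. LBINT s:{0..N}. \<bar>t - s\<bar> powr \<alpha>)
      = (LBINT t:{0..N}. (ppow (\<alpha> + 1) t + ppow (\<alpha> + 1) (N - t)) / (\<alpha> + 1))"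
    by (intro set_lebesgue_integral_cong) (auto simp: inner)
  also have "\<dots> = ((ppow (\<alpha> + 2) N - ppow (\<alpha> + 2) 0) / (\<alpha> + 2)
        + (ppow (\<alpha> + 2) N - ppow (\<alpha> + 2) 0) / (\<alpha> + 2)) / (\<alpha> + 1)"
  proof -
    have hb: "has_bochner_integral lborel (\<lambda>t. (indicator {0..N} t * ppow (\<alpha> + 1) (t - 0) + indicator {0..N} t * ppow (\<alpha> + 1) (N - t)) / (\<alpha> + 1))
      (((ppow (\<alpha> + 1 + 1) (N - 0) - ppow (\<alpha> + 1 + 1) (0 - 0)) / (\<alpha> + 1 + 1)
        + (ppow (\<alpha> + 1 + 1) (N - 0) - ppow (\<alpha> + 1 + 1) (N - N)) / (\<alpha> + 1 + 1)) / (\<alpha> + 1))"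
      using \<alpha> N by (intro has_bochner_integral_divide_zero has_bochner_integral_add ppow_shift_integral) auto
    have "indicator {0..N} t *\<^sub>R ((ppow (\<alpha> + 1) t + ppow (\<alpha> + 1) (N - t)) / (\<alpha> + 1))
        = (indicator {0..N} t * ppow (\<alpha> + 1) (t - 0) + indicator {0..N} t * ppow (\<alpha> + 1) (N - t)) / (\<alpha> + 1)" for t
      by (simp add: distrib_left)
    then show ?thesis
      unfolding set_lebesgue_integral_def by (simp only: has_bochner_integral_integral_eq[OF hb]) (simp add: add.assoc)
  qed
  also have "\<dots> = 2 * N powr (\<alpha> + 2) / ((\<alpha> + 1) * (\<alpha> + 2))"
    using N by (cases "N = 0") (simp_all add: ppow_def)
  finally show ?thesis .
qed

lemma set_integral_bounded_Icc:
  fixes h :: "real \<Rightarrow> 'b::{banach, second_countable_topology}"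
  assumes [measurable]: "h \<in> borel_measurable borel" and b: "\<And>x. x \<in> {0..N} \<Longrightarrow> norm (h x) \<le> K" and N: "0 \<le> N"
  shows "set_integrable lborel {0..N} h" "norm (LBINT x:{0..N}. h x) \<le> K * N"
proof -
  show int: "set_integrable lborel {0..N} h"
    unfolding set_integrable_def using b N
    by (intro integrableI_bounded_set_indicator[where B=K]) auto
  have "norm (LBINT x:{0..N}. h x) \<le> (LBINT x:{0..N}. norm (h x))"
    using int by (rule set_integral_norm_bound)
  also have "\<dots> \<le> (LBINT x:{0..N}. K)"
    using N by (intro set_integral_mono set_integrable_norm int b) (auto simp: set_integrable_def)
  also have "\<dots> = K * N" using N by (simp add: set_lebesgue_integral_def)
  finally show "norm (LBINT x:{0..N}. h x) \<le> K * N" .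
qed

text \<open>Serves to replace the characteristic function in the form factor by its quadratic
  approximation. The bounds \<open>K\<close> and \<open>K'\<close> give the integrability that
  linearity requires; the estimate itself depends on \<open>\<delta>\<close> alone.\<close>

lemma double_integral_diff_bound:
  fixes f g :: "real \<Rightarrow> real \<Rightarrow> complex"
  assumes [measurable]: "case_prod f \<in> borel_measurable (borel \<Otimes>\<^sub>M borel)" "case_prod g \<in> borel_measurable (borel \<Otimes>\<^sub>M borel)"
    and b: "\<And>t s. t \<in> {0..N} \<Longrightarrow> s \<in> {0..N} \<Longrightarrow> norm (f t s) \<le> K"
      "\<And>t s. t \<in> {0..N} \<Longrightarrow> s \<in> {0..N} \<Longrightarrow> norm (g t s) \<le> K'"
    and d: "\<And>t s. t \<in> {0..N} \<Longrightarrow> s \<in> {0..N} \<Longrightarrow> norm (f t s - g t s) \<le> \<delta>" and N: "0 \<le> N"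
  shows "norm ((LBINT t:{0..N}. LBINT s:{0..N}. f t s) - (LBINT t:{0..N}. LBINT s:{0..N}. g t s)) \<le> \<delta> * N\<^sup>2"
proof -
  let ?I = "\<lambda>f t. LBINT s:{0..N}. f t s"
  have [measurable]: "?I f \<in> borel_measurable borel" "?I g \<in> borel_measurable borel"
    unfolding set_lebesgue_integral_def by measurable
  have fi: "set_integrable lborel {0..N} (f t)" "norm (?I f t) \<le> K * N" if "t \<in> {0..N}" for t
    using set_integral_bounded_Icc[of "f t" N K] b(1)[OF that] N by auto
  have gi: "set_integrable lborel {0..N} (g t)" "norm (?I g t) \<le> K' * N" if "t \<in> {0..N}" for t
    using set_integral_bounded_Icc[of "g t" N K'] b(2)[OF that] N by auto
  have diff: "?I f t - ?I g t = ?I (\<lambda>t s. f t s - g t s) t" if "t \<in> {0..N}" for t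
    using set_integral_diff(2)[OF fi(1)[OF that] gi(1)[OF that]] by simp
  have "norm (?I f t - ?I g t) \<le> \<delta> * N" if "t \<in> {0..N}" for t
    unfolding diff[OF that] using d[OF that] N by (intro set_integral_bounded_Icc(2)) auto
  then have "norm (LBINT t:{0..N}. ?I f t - ?I g t) \<le> \<delta> * N * N"
    using N by (intro set_integral_bounded_Icc(2)) auto
  moreover have "set_integrable lborel {0..N} (?I f)"
    by (rule set_integral_bounded_Icc(1)[OF _ fi(2) N]) simp_all
  moreover have "set_integrable lborel {0..N} (?I g)"
    by (rule set_integral_bounded_Icc(1)[OF _ gi(2) N]) simp_all
  ultimately show ?thesis
    by (simp add: set_integral_diff(2) power2_eq_square mult.assoc)
qed

section \<open>The Mittag-Leffler function near zero\<close>

text \<open>On the compact interval [1,2] Gamma attains a positive minimum. For \<open>x > 2\<close>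
  the recursion \<open>Gamma x = (x - 1) * Gamma (x - 1)\<close> multiplies by a factor of at least
  1, so the minimum persists on [1, n + 2] by induction on \<open>n\<close>.\<close>

lemma Gamma_ge_1_bound: "\<exists>m>0. \<forall>x\<ge>(1::real). m \<le> Gamma x"
proof -
  have "continuous_on {1..2} (Gamma :: real \<Rightarrow> real)"
    by (intro continuous_intros) (auto elim!: nonpos_Ints_cases)
  then obtain y :: real where y: "y \<in> {1..2}" "\<And>x. x \<in> {1..2} \<Longrightarrow> Gamma y \<le> Gamma x"
    using continuous_attains_inf[of "{1..2::real}" Gamma] by auto
  have step: "\<forall>x. 1 \<le> x \<and> x \<le> real n + 2 \<longrightarrow> Gamma y \<le> Gamma x" for n
  proof (induction n)
    case 0
    then show ?case using y by auto
  next
    case (Suc n)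
    show ?case
    proof (intro allI impI)
      fix x :: real assume x: "1 \<le> x \<and> x \<le> real (Suc n) + 2"
      show "Gamma y \<le> Gamma x"
      proof (cases "x \<le> 2")
        case False
        then have nI: "x - 1 \<notin> \<int>\<^sub>\<le>\<^sub>0" by (auto elim!: nonpos_Ints_cases)
        have "Gamma x = (x - 1) * Gamma (x - 1)"
          using Gamma_plus1[of "x - 1", OF nI] by simp
        moreover have "Gamma y \<le> Gamma (x - 1)" using Suc x False by auto
        moreover have "0 < Gamma y" using y by (intro Gamma_real_pos) auto
        ultimately show ?thesis
          using False mult_mono[of 1 "x - 1" "Gamma y" "Gamma (x - 1)"] by simp
      qed (use x y in auto)
    qed
  qed
  have "Gamma y \<le> Gamma x" if "1 \<le> x" for x
  proof -
    obtain n where "x \<le> real n" using real_arch_simple by blast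
    then show ?thesis using step[of n] that by auto
  qed
  then show ?thesis using y by (intro exI[of _ "Gamma y"]) (auto intro!: Gamma_real_pos)
qed

text \<open>The arguments \<open>\<beta> * j + 1\<close> are at least 1, where Gamma is bounded away
  from 0. Bounded coefficients already give convergence on the open unit disc.\<close>

lemma mittag_leffler_coeff_bound:
  assumes "0 \<le> \<beta>"
  shows "\<exists>M\<ge>0. \<forall>j. norm (1 / complex_of_real (Gamma (\<beta> * real j + 1))) \<le> M"
proof -
  obtain m where m: "0 < m" "\<And>x::real. 1 \<le> x \<Longrightarrow> m \<le> Gamma x" using Gamma_ge_1_bound by auto
  have "norm (1 / complex_of_real (Gamma (\<beta> * real j + 1))) \<le> 1 / m" for j
  proof -
    have "m \<le> Gamma (\<beta> * real j + 1)" using assms by (intro m) simp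
    then show ?thesis using m(1) by (simp add: norm_divide frac_le)
  qed
  then show ?thesis using m(1) by (intro exI[of _ "1 / m"]) auto
qed

lemma mittag_leffler_summable:
  assumes "0 \<le> \<beta>" "norm z < 1"
  shows "summable (\<lambda>j. 1 / of_real (Gamma (\<beta> * real j + 1)) * z ^ j :: complex)"
proof -
  obtain M where M: "0 \<le> M" "\<And>j. norm (1 / complex_of_real (Gamma (\<beta> * real j + 1))) \<le> M"
    using mittag_leffler_coeff_bound[OF assms(1)] by auto
  show ?thesis
  proof (rule summable_comparison_test')
    show "summable (\<lambda>j. M * norm z ^ j)"
      using assms(2) by (intro summable_mult summable_geometric) simp
    show "norm (1 / complex_of_real (Gamma (\<beta> * real j + 1)) * z ^ j) \<le> M * norm z ^ j" if "0 \<le> j" for j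
      unfolding norm_mult norm_power by (intro mult_right_mono M) simp
  qed
qed

lemma mittag_leffler_powser:
  "mittag_leffler \<beta> = (\<lambda>z. \<Sum>j. 1 / of_real (Gamma (\<beta> * real j + 1)) * z ^ j)"
  by (simp add: mittag_leffler_def fun_eq_iff)

lemma mittag_leffler_isCont:
  assumes "0 \<le> \<beta>" "norm z < 1"
  shows "isCont (mittag_leffler \<beta>) z"
proof -
  obtain r where r: "norm z < r" "r < 1" using assms(2) dense by blast
  then have r0: "0 \<le> r" using norm_ge_zero[of z] by linarith
  have "summable (\<lambda>j. 1 / of_real (Gamma (\<beta> * real j + 1)) * (of_real r :: complex) ^ j)"
    using r r0 by (intro mittag_leffler_summable assms) auto
  then show ?thesis
    unfolding mittag_leffler_powser using r r0
    by (intro isCont_powser[where K="of_real r"]) auto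
qed

text \<open>The terms from index 2 on are dominated by a geometric series of ratio 1/2, whence the
  constant \<open>2 * M\<close>. Its independence of \<open>z\<close> later makes the expansion
  uniform in the two times.\<close>

lemma mittag_leffler_second_order:
  assumes "0 \<le> \<beta>"
  shows "\<exists>C\<ge>0. \<forall>z. norm z \<le> 1/2 \<longrightarrow>
    norm (mittag_leffler \<beta> z - (1 + z / of_real (Gamma (\<beta> + 1)))) \<le> C * (norm z)\<^sup>2"
proof -
  obtain M where M: "0 \<le> M" "\<And>j. norm (1 / complex_of_real (Gamma (\<beta> * real j + 1))) \<le> M"
    using mittag_leffler_coeff_bound[OF assms] by auto
  have "norm (mittag_leffler \<beta> z - (1 + z / of_real (Gamma (\<beta> + 1)))) \<le> 2 * M * (norm z)\<^sup>2"
    if z: "norm z \<le> 1/2" for z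
  proof -
    let ?t = "\<lambda>j. 1 / complex_of_real (Gamma (\<beta> * real j + 1)) * z ^ j"
    have sm: "summable ?t" using z by (intro mittag_leffler_summable assms) auto
    have "mittag_leffler \<beta> z = (\<Sum>j. ?t (j + 2)) + (\<Sum>j<2. ?t j)"
      unfolding mittag_leffler_powser by (rule suminf_split_initial_segment[OF sm])
    also have "(\<Sum>j<2. ?t j) = 1 + z / of_real (Gamma (\<beta> + 1))"
      by (simp add: numeral_2_eq_2)
    finally have "mittag_leffler \<beta> z - (1 + z / of_real (Gamma (\<beta> + 1))) = (\<Sum>j. ?t (j + 2))" by simp
    also have "norm \<dots> \<le> (\<Sum>j. M * (norm z)\<^sup>2 * (1/2) ^ j)"
    proof (rule norm_suminf_le)
      show "summable (\<lambda>j. M * (norm z)\<^sup>2 * (1/2) ^ j)"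
        by (intro summable_mult summable_geometric) simp
      show "norm (?t (j + 2)) \<le> M * (norm z)\<^sup>2 * (1/2) ^ j" for j
      proof -
        have "norm (?t (j + 2)) \<le> M * ((norm z)\<^sup>2 * norm z ^ j)"
          unfolding norm_mult norm_power power_add mult.commute[of "norm z ^ j"]
          by (intro mult_right_mono M) simp
        also have "\<dots> \<le> M * ((norm z)\<^sup>2 * (1/2) ^ j)"
          using M(1) z by (intro mult_left_mono power_mono) auto
        finally show ?thesis by simp
      qed
    qed
    also have "\<dots> = 2 * M * (norm z)\<^sup>2"
      by (subst suminf_mult) (auto simp: suminf_geometric summable_geometric)
    finally show ?thesis .
  qed
  then show ?thesis using M(1) by (intro exI[of _ "2 * M"]) auto
qed

text \<open>The functions \<open>f n = (2 - 2 * cos (u n * X)) / (u n)\<^sup>2\<close> are second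
  difference quotients at 0: they lie below \<open>X\<^sup>2\<close>, converge to it pointwise, and
  have expectations known from the characteristic function. Square integrability of \<open>X\<close>
  is thus a conclusion. The restriction on \<open>u\<close> keeps the argument of
  \<open>mittag_leffler\<close> in the disc of radius 1/2.\<close>

lemma (in prob_space) mittag_leffler_char_second_moment:
  fixes X :: "'a \<Rightarrow> real"
  assumes X [measurable]: "X \<in> borel_measurable M" and c: "0 \<le> c" and \<beta>: "0 < \<beta>"
    and cf: "\<And>u. u\<^sup>2 * c \<le> 1 \<Longrightarrow>
      (LINT w|M. exp (\<i> * of_real (u * X w))) = mittag_leffler \<beta> (of_real (- (u\<^sup>2 * c / 2)))"
  shows "has_bochner_integral M (\<lambda>w. (X w)\<^sup>2) (c / Gamma (\<beta> + 1))"
proof -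
  \<comment> \<open>With this choice \<open>\<delta>\<^sup>2 * c \<le> 1\<close>, also when
    \<open>c = 0\<close>, so every \<open>u n\<close> is admissible in the hypothesis on the
    characteristic function.\<close>
  define \<delta> where "\<delta> = 1 / (1 + c)"
  define u where "u = (\<lambda>n. \<delta> / (real n + 1))"
  \<comment> \<open>The half-angle form makes the limit a derivative of the sine at 0 and the upper
    bound an instance of \<open>\<bar>sin x\<bar> \<le> \<bar>x\<bar>\<close>.\<close>
  define f where "f = (\<lambda>n w. (sin (u n / 2 * X w) / (u n / 2))\<^sup>2)"
  obtain C where C: "0 \<le> C" "\<And>z. norm z \<le> 1/2 \<Longrightarrow>
      norm (mittag_leffler \<beta> z - (1 + z / of_real (Gamma (\<beta> + 1)))) \<le> C * (norm z)\<^sup>2"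
    using mittag_leffler_second_order[of \<beta>] \<beta> by auto
  have G: "0 < Gamma (\<beta> + 1)" using \<beta> by (intro Gamma_real_pos) auto
  have \<delta>: "0 < \<delta>" "\<delta>\<^sup>2 * c \<le> 1"
  proof -
    have "c \<le> (1 + c)\<^sup>2" using c by (simp add: power2_eq_square algebra_simps)
    then show "\<delta>\<^sup>2 * c \<le> 1" using c by (simp add: \<delta>_def power_divide divide_le_eq)
  qed (use c in \<open>simp add: \<delta>_def\<close>)
  have u: "0 < u n" "u n \<le> \<delta>" for n
    using \<delta> by (auto simp: u_def divide_le_eq mult_le_cancel_left1)
  have uc: "(u n)\<^sup>2 * c \<le> 1" for n
    using mult_right_mono[OF power_mono[OF u(2), of n 2] c] u(1)[of n] \<delta>(2) by simp
  have u0: "u \<longlonglongrightarrow> 0"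
    unfolding u_def using tendsto_mult_right_zero[OF LIMSEQ_inverse_real_of_nat, of \<delta>]
    by (simp add: field_simps)
  have f_lim: "(\<lambda>n. f n w) \<longlonglongrightarrow> (X w)\<^sup>2" for w
  proof -
    have "DERIV (\<lambda>v. sin (v * X w)) 0 :> X w" by (auto intro!: derivative_eq_intros)
    then have "((\<lambda>v. sin (v * X w) / v) \<longlongrightarrow> X w) (at 0)" by (simp add: DERIV_def)
    moreover have "filterlim (\<lambda>n. u n / 2) (at 0) sequentially"
      unfolding filterlim_at using u(1) tendsto_divide[OF u0 tendsto_const[of 2]]
      by (auto simp: less_imp_neq[symmetric] intro!: always_eventually)
    ultimately have "(\<lambda>n. sin (u n / 2 * X w) / (u n / 2)) \<longlonglongrightarrow> X w"
      by (rule filterlim_compose)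
    then show ?thesis unfolding f_def by (rule tendsto_power)
  qed
  have f_le: "f n w \<le> (X w)\<^sup>2" for n w
  proof -
    have "\<bar>sin (u n / 2 * X w)\<bar> \<le> \<bar>X w\<bar> * (u n / 2)"
      using abs_sin_x_le_abs_x[of "u n / 2 * X w"] u(1)[of n] by (simp add: abs_mult mult_ac)
    then have "\<bar>sin (u n / 2 * X w) / (u n / 2)\<bar> \<le> \<bar>X w\<bar>"
      using u(1)[of n] by (simp add: abs_divide divide_le_eq)
    then show ?thesis unfolding f_def by (simp only: abs_le_square_iff)
  qed
  have f_cos: "f n w = (2 - 2 * cos (u n * X w)) / (u n)\<^sup>2" for n w
    using cos_double_sin[of "u n / 2 * X w"] u(1)[of n] by (simp add: f_def power_divide field_simps)
  have [measurable]: "f n \<in> borel_measurable M" for n unfolding f_def by measurable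
  have cos_int: "integrable M (\<lambda>w. cos (u n * X w))" for n
    by (intro integrable_const_bound[where B=1]) auto
  have f_int: "integrable M (f n)" for n
    unfolding f_cos using cos_int[of n] by simp
  have f_val: "(LINT w|M. f n w) = (2 - 2 * Re (mittag_leffler \<beta> (of_real (- ((u n)\<^sup>2 * c / 2))))) / (u n)\<^sup>2" for n
  proof -
    have e: "integrable M (\<lambda>w. exp (\<i> * of_real (u n * X w)))"
      by (intro integrable_iexp) auto
    have "(LINT w|M. cos (u n * X w)) = Re (LINT w|M. exp (\<i> * of_real (u n * X w)))"
      by (subst integral_Re[OF e, symmetric]) (simp add: Re_exp)
    then have "(LINT w|M. cos (u n * X w)) = Re (mittag_leffler \<beta> (of_real (- ((u n)\<^sup>2 * c / 2))))"
      unfolding cf[OF uc] .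
    then show ?thesis
      unfolding f_cos using cos_int[of n] by (simp add: prob_space)
  qed
  \<comment> \<open>The linear term of the expansion contributes exactly
    \<open>c / Gamma (\<beta> + 1)\<close>; the quadratic remainder, doubled and divided by
    \<open>(u n)\<^sup>2\<close>, is still of order \<open>(u n)\<^sup>2\<close>.\<close>
  have f_bound: "\<bar>(LINT w|M. f n w) - c / Gamma (\<beta> + 1)\<bar> \<le> C * c\<^sup>2 / 2 * (u n)\<^sup>2" for n
  proof -
    define z where "z = - ((u n)\<^sup>2 * c / 2)"
    let ?E = "mittag_leffler \<beta> (of_real z)"
    have z: "norm (complex_of_real z) \<le> 1/2"
      unfolding norm_of_real using uc[of n] c by (simp add: z_def abs_mult)
    have "Re (?E - (1 + of_real z / of_real (Gamma (\<beta> + 1)))) = Re ?E - (1 + z / Gamma (\<beta> + 1))"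
      by simp
    then have "\<bar>Re ?E - (1 + z / Gamma (\<beta> + 1))\<bar> \<le> C * z\<^sup>2"
      using order_trans[OF abs_Re_le_cmod C(2)[OF z]] unfolding norm_of_real power2_abs by metis
    moreover have "(LINT w|M. f n w) - c / Gamma (\<beta> + 1)
        = - 2 * (Re (mittag_leffler \<beta> (of_real z)) - (1 + z / Gamma (\<beta> + 1))) / (u n)\<^sup>2"
      unfolding f_val z_def[symmetric] using u(1)[of n] G by (simp add: z_def field_simps)
    ultimately have "\<bar>(LINT w|M. f n w) - c / Gamma (\<beta> + 1)\<bar> \<le> 2 * (C * z\<^sup>2) / (u n)\<^sup>2"
      using u(1)[of n] by (simp add: abs_mult divide_right_mono)
    also have "\<dots> = C * c\<^sup>2 / 2 * (u n)\<^sup>2"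
      using u(1)[of n] by (simp add: z_def power2_eq_square)
    finally show ?thesis .
  qed
  have lim: "(\<lambda>n. LINT w|M. f n w) \<longlonglongrightarrow> c / Gamma (\<beta> + 1)"
  proof -
    have "(\<lambda>n. C * c\<^sup>2 / 2 * (u n)\<^sup>2) \<longlonglongrightarrow> C * c\<^sup>2 / 2 * 0\<^sup>2"
      by (intro tendsto_intros u0)
    then have 0: "(\<lambda>n. C * c\<^sup>2 / 2 * (u n)\<^sup>2) \<longlonglongrightarrow> 0" by simp
    have "(\<lambda>n. (LINT w|M. f n w) - c / Gamma (\<beta> + 1)) \<longlonglongrightarrow> 0"
      by (rule Lim_null_comparison[OF _ 0]) (simp only: real_norm_def f_bound eventually_True)
    then show ?thesis by (rule LIM_zero_cancel)
  qed
  \<comment> \<open>Fatou's lemma gives integrability, which then makes \<open>X\<^sup>2\<close> a dominating function.\<close>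
  have int: "integrable M (\<lambda>w. (X w)\<^sup>2)"
  proof (rule integrableI_nonneg)
    have "(\<integral>\<^sup>+w. ennreal ((X w)\<^sup>2) \<partial>M) = (\<integral>\<^sup>+w. liminf (\<lambda>n. ennreal (f n w)) \<partial>M)"
      by (intro nn_integral_cong lim_imp_Liminf[symmetric] tendsto_ennrealI f_lim) auto
    also have "\<dots> \<le> liminf (\<lambda>n. \<integral>\<^sup>+w. ennreal (f n w) \<partial>M)"
      by (intro nn_integral_liminf) auto
    also have "\<dots> = liminf (\<lambda>n. ennreal (LINT w|M. f n w))"
      by (subst nn_integral_eq_integral[OF f_int]) (auto simp: f_def)
    also have "\<dots> = ennreal (c / Gamma (\<beta> + 1))"
      by (intro lim_imp_Liminf tendsto_ennrealI lim) auto
    finally show "(\<integral>\<^sup>+w. ennreal ((X w)\<^sup>2) \<partial>M) < \<infinity>"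
      by (rule order_le_less_trans) auto
  qed auto
  have "(\<lambda>n. LINT w|M. f n w) \<longlonglongrightarrow> (LINT w|M. (X w)\<^sup>2)"
    using f_le f_lim by (intro integral_dominated_convergence[where w="\<lambda>w. (X w)\<^sup>2"] int) (auto simp: f_def)
  with lim have "(LINT w|M. (X w)\<^sup>2) = c / Gamma (\<beta> + 1)"
    by (rule LIMSEQ_unique[symmetric])
  with int show ?thesis by (simp add: has_bochner_integral_iff)
qed

section \<open>Pairings with square-integrable functions\<close>

text \<open>The hypothesis is the form that weighted arithmetic-geometric estimates take after
  integration. Taking \<open>\<epsilon>\<close> of the size of \<open>sqrt (d i)\<close> sends both
  summands to 0 and replaces the Cauchy--Schwarz inequality for integrals.\<close>

lemma tendsto_0_weighted_bound:
  fixes c :: "nat \<Rightarrow> 'a::real_normed_vector" and d :: "nat \<Rightarrow> real"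
  assumes bound: "\<And>\<epsilon> i. 0 < \<epsilon> \<Longrightarrow> norm (c i) \<le> \<epsilon> * K + (1 + 1 / \<epsilon>) * d i"
    and d: "\<And>i. 0 \<le> d i" "d \<longlonglongrightarrow> 0"
  shows "c \<longlonglongrightarrow> 0"
proof (rule Lim_null_comparison)
  \<comment> \<open>The second summand only keeps \<open>e i\<close> positive when \<open>d i = 0\<close>.\<close>
  define e where "e = (\<lambda>i. sqrt (d i) + inverse (real (Suc i)))"
  have e: "0 < e i" for i using d(1)[of i] by (auto simp: e_def intro!: add_nonneg_pos)
  have "norm (c i) \<le> e i * K + (d i + sqrt (d i))" for i
  proof -
    have "sqrt (d i) * sqrt (d i) \<le> sqrt (d i) * e i"
      using d(1)[of i] by (intro mult_left_mono) (auto simp: e_def)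
    then have "d i / e i \<le> sqrt (d i)" using e[of i] d(1)[of i] by (simp add: divide_le_eq)
    then show ?thesis using bound[OF e[of i], of i] by (simp add: algebra_simps)
  qed
  then show "\<forall>\<^sub>F i in sequentially. norm (c i) \<le> e i * K + (d i + sqrt (d i))"
    by (intro always_eventually allI)
  have "e \<longlonglongrightarrow> sqrt 0 + 0"
    unfolding e_def by (intro tendsto_intros d LIMSEQ_inverse_real_of_nat)
  then have "(\<lambda>i. e i * K + (d i + sqrt (d i))) \<longlonglongrightarrow> (sqrt 0 + 0) * K + (0 + sqrt 0)"
    by (intro tendsto_intros d)
  then show "(\<lambda>i. e i * K + (d i + sqrt (d i))) \<longlonglongrightarrow> 0" by simp
qed

text \<open>From \<open>2 * \<epsilon> * \<bar>x\<bar> \<le> \<epsilon>\<^sup>2 + x\<^sup>2\<close>;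
  the coefficients are rounded up to the shape required by
  \<open>tendsto_0_weighted_bound\<close>.\<close>

lemma abs_le_weighted_square: "0 < \<epsilon> \<Longrightarrow> \<bar>x\<bar> \<le> \<epsilon> + (1 + 1 / \<epsilon>) * x\<^sup>2" for \<epsilon> x :: real
proof -
  assume e: "0 < \<epsilon>"
  have "0 \<le> (\<epsilon> - \<bar>x\<bar>)\<^sup>2" by simp
  then have "\<epsilon> * \<bar>x\<bar> + \<epsilon> * \<bar>x\<bar> \<le> \<epsilon> * \<epsilon> + x\<^sup>2"
    by (simp add: power2_eq_square algebra_simps)
  moreover have "0 \<le> \<epsilon> * \<bar>x\<bar>" "0 \<le> \<epsilon> * x\<^sup>2" using e by auto
  ultimately have "\<bar>x\<bar> * \<epsilon> \<le> \<epsilon> * \<epsilon> + x\<^sup>2 + \<epsilon> * x\<^sup>2" by (simp add: mult.commute)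
  then have "\<bar>x\<bar> \<le> (\<epsilon> * \<epsilon> + x\<^sup>2 + \<epsilon> * x\<^sup>2) / \<epsilon>" using e by (simp add: le_divide_eq)
  also have "\<dots> = \<epsilon> + (1 + 1 / \<epsilon>) * x\<^sup>2" using e by (simp add: field_simps)
  finally show ?thesis .
qed

text \<open>With \<open>c = a - b\<close> the difference of squares is
  \<open>2 * (b \<bullet> c) + (norm c)\<^sup>2\<close>, and the cross term is split by a weighted
  arithmetic-geometric inequality.\<close>

lemma norm_square_diff_weighted:
  fixes a b :: "'a::real_inner"
  assumes e: "0 < \<epsilon>"
  shows "\<bar>(norm a)\<^sup>2 - (norm b)\<^sup>2\<bar> \<le> \<epsilon> * (norm b)\<^sup>2 + (1 + 1 / \<epsilon>) * (norm (a - b))\<^sup>2"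
proof -
  define c where "c = a - b"
  have a: "a = b + c" by (simp add: c_def)
  have "(norm a)\<^sup>2 - (norm b)\<^sup>2 = 2 * (b \<bullet> c) + (norm c)\<^sup>2"
    unfolding a power2_norm_eq_inner by (simp add: inner_simps inner_commute)
  moreover have "2 * \<bar>b \<bullet> c\<bar> \<le> \<epsilon> * (norm b)\<^sup>2 + (norm c)\<^sup>2 / \<epsilon>"
  proof -
    have "0 \<le> (\<epsilon> * norm b - norm c)\<^sup>2" by simp
    then have "(2 * (norm b * norm c)) * \<epsilon> \<le> (\<epsilon> * (norm b)\<^sup>2) * \<epsilon> + (norm c)\<^sup>2"
      by (simp add: power2_eq_square algebra_simps)
    then have "2 * (norm b * norm c) \<le> ((\<epsilon> * (norm b)\<^sup>2) * \<epsilon> + (norm c)\<^sup>2) / \<epsilon>"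
      using e by (simp add: le_divide_eq)
    also have "\<dots> = \<epsilon> * (norm b)\<^sup>2 + (norm c)\<^sup>2 / \<epsilon>" using e by (simp add: add_divide_distrib)
    finally show ?thesis using Cauchy_Schwarz_ineq2[of b c] by linarith
  qed
  moreover have "(1 + 1 / \<epsilon>) * (norm c)\<^sup>2 = (norm c)\<^sup>2 + (norm c)\<^sup>2 / \<epsilon>" by (simp add: algebra_simps)
  moreover have "0 \<le> (norm c)\<^sup>2" by simp
  ultimately show ?thesis unfolding c_def[symmetric] by linarith
qed

lemma norm_lincomb_square_le:
  "(norm (a *\<^sub>R x + b *\<^sub>R y))\<^sup>2 \<le> 2 * a\<^sup>2 * (norm x)\<^sup>2 + 2 * b\<^sup>2 * (norm y)\<^sup>2"
proof -
  have "(norm (a *\<^sub>R x + b *\<^sub>R y))\<^sup>2 \<le> (\<bar>a\<bar> * norm x + \<bar>b\<bar> * norm y)\<^sup>2"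
    using norm_triangle_ineq[of "a *\<^sub>R x" "b *\<^sub>R y"] by (intro power_mono) auto
  also have "\<dots> \<le> 2 * (\<bar>a\<bar> * norm x)\<^sup>2 + 2 * (\<bar>b\<bar> * norm y)\<^sup>2"
    using zero_le_power2[of "\<bar>a\<bar> * norm x - \<bar>b\<bar> * norm y"] by (simp add: power2_eq_square algebra_simps)
  finally show ?thesis by (simp add: power_mult_distrib)
qed

section \<open>Schwartz functions\<close>

lemma schwartzD:
  assumes "f \<in> schwartz"
  shows "(deriv ^^ k) f field_differentiable at x"
    and "bdd_above (range (\<lambda>x. \<bar>x ^ m * (deriv ^^ k) f x\<bar>))"
  using assms by (auto simp: schwartz_def)

lemma funpow_deriv_lincomb:
  assumes "f \<in> schwartz" "g \<in> schwartz"
  shows "(deriv ^^ k) (\<lambda>x. a * f x + b * g x) = (\<lambda>x. a * (deriv ^^ k) f x + b * (deriv ^^ k) g x)"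
proof (induction k)
  case (Suc k)
  have "(deriv ^^ k) f field_differentiable at x" "(deriv ^^ k) g field_differentiable at x" for x
    using assms by (auto simp: schwartz_def)
  then show ?case
    by (simp add: Suc fun_eq_iff deriv_add deriv_cmult field_differentiable_mult field_differentiable_const)
qed simp

lemma schwartz_lincomb:
  assumes "f \<in> schwartz" "g \<in> schwartz"
  shows "(\<lambda>x. a * f x + b * g x) \<in> schwartz"
proof -
  have d: "(deriv ^^ k) f field_differentiable at x" "(deriv ^^ k) g field_differentiable at x" for x k
    using assms by (auto simp: schwartz_def)
  have "bdd_above (range (\<lambda>x. \<bar>x ^ m * (a * (deriv ^^ k) f x + b * (deriv ^^ k) g x)\<bar>))" for m k
  proof -
    obtain A where A: "\<And>x. \<bar>x ^ m * (deriv ^^ k) f x\<bar> \<le> A"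
      using assms(1) by (force simp: schwartz_def bdd_above_def)
    obtain A' where A': "\<And>x. \<bar>x ^ m * (deriv ^^ k) g x\<bar> \<le> A'"
      using assms(2) by (force simp: schwartz_def bdd_above_def)
    have "\<bar>x ^ m * (a * (deriv ^^ k) f x + b * (deriv ^^ k) g x)\<bar> \<le> \<bar>a\<bar> * A + \<bar>b\<bar> * A'" for x
    proof -
      have "x ^ m * (a * (deriv ^^ k) f x + b * (deriv ^^ k) g x)
          = a * (x ^ m * (deriv ^^ k) f x) + b * (x ^ m * (deriv ^^ k) g x)" by (simp add: algebra_simps)
      also have "\<bar>\<dots>\<bar> \<le> \<bar>a * (x ^ m * (deriv ^^ k) f x)\<bar> + \<bar>b * (x ^ m * (deriv ^^ k) g x)\<bar>"
        by (rule abs_triangle_ineq)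
      also have "\<dots> \<le> \<bar>a\<bar> * A + \<bar>b\<bar> * A'"
        unfolding abs_mult[of a] abs_mult[of b] using A[of x] A'[of x]
        by (intro add_mono mult_left_mono) auto
      finally show ?thesis .
    qed
    then show ?thesis by (auto simp: bdd_above_def)
  qed
  moreover have "(\<lambda>x. a * (deriv ^^ k) f x + b * (deriv ^^ k) g x) field_differentiable at x" for x k
    using d by (intro field_differentiable_add field_differentiable_mult field_differentiable_const)
  ultimately show ?thesis
    unfolding schwartz_def mem_Collect_eq funpow_deriv_lincomb[OF assms] by blast
qed

lemma schwartz_zero: "(\<lambda>x. 0) \<in> schwartz"
proof -
  have "(deriv ^^ k) (\<lambda>x::real. 0::real) = (\<lambda>x. 0)" for k
    by (induction k) auto
  then show ?thesis by (simp add: schwartz_def)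
qed

lemma schwartz_measurable: "f \<in> schwartz \<Longrightarrow> f \<in> borel_measurable borel"
proof -
  assume "f \<in> schwartz"
  then have "isCont f x" for x
    using schwartzD(1)[of f 0 x] by (auto intro: field_differentiable_imp_continuous_at)
  then show ?thesis by (intro borel_measurable_continuous_onI) (simp add: continuous_at_imp_continuous_on)
qed

text \<open>Boundedness of \<open>f x\<close> and of \<open>x * f x\<close> bounds
  \<open>(f x)\<^sup>2 * (1 + x\<^sup>2)\<close>, so that \<open>f\<^sup>2\<close> is dominated by a
  multiple of the Cauchy density.\<close>

lemma schwartz_square_integrable:
  assumes f: "f \<in> schwartz"
  shows "integrable lborel (\<lambda>x. (f x)\<^sup>2)"
proof -
  note [measurable] = schwartz_measurable[OF f]
  note bd = schwartzD(2)[OF f, of _ 0]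
  obtain A where A: "\<And>x. \<bar>x ^ 0 * (deriv ^^ 0) f x\<bar> \<le> A"
    using bd[of 0] by (force simp: bdd_above_def)
  obtain A' where A': "\<And>x. \<bar>x ^ 1 * (deriv ^^ 0) f x\<bar> \<le> A'"
    using bd[of 1] by (force simp: bdd_above_def)
  have le: "(f x)\<^sup>2 \<le> (A\<^sup>2 + A'\<^sup>2) * inverse (1 + x\<^sup>2)" for x
  proof -
    have "(f x)\<^sup>2 \<le> A\<^sup>2" using A[of x] power_mono[of "\<bar>f x\<bar>" A 2] by simp
    moreover have "(x * f x)\<^sup>2 \<le> A'\<^sup>2" using A'[of x] power_mono[of "\<bar>x * f x\<bar>" A' 2] by simp
    ultimately have "(f x)\<^sup>2 * (1 + x\<^sup>2) \<le> A\<^sup>2 + A'\<^sup>2" by (simp add: algebra_simps)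
    moreover have "0 < 1 + x\<^sup>2" by (simp add: add_pos_nonneg)
    ultimately show ?thesis by (simp add: field_simps)
  qed
  have "integrable lborel (\<lambda>x::real. inverse (1 + x\<^sup>2))"
    using integrable_inverse_1_plus_square by (simp add: set_integrable_def)
  then have "integrable lborel (\<lambda>x. (A\<^sup>2 + A'\<^sup>2) * inverse (1 + x\<^sup>2))" by (rule integrable_mult_right)
  then show ?thesis by (rule Bochner_Integration.integrable_bound) (use le in \<open>auto intro!: AE_I2 order_trans[OF le] abs_ge_self\<close>)
qed

section \<open>Square-integrable vector-valued functions\<close>

definition L2_vec :: "(real \<Rightarrow> real ^ 'd::finite) \<Rightarrow> bool" where
  "L2_vec \<phi> \<longleftrightarrow> \<phi> \<in> borel_measurable lborel \<and> integrable lborel (\<lambda>x. (norm (\<phi> x))\<^sup>2)"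

lemma norm_vec_square: "(norm x)\<^sup>2 = (\<Sum>j\<in>UNIV. (x $ j)\<^sup>2)" for x :: "real ^ 'd::finite"
  unfolding power2_norm_eq_inner inner_vec_def by (simp add: power2_eq_square)

lemma L2_vec_component:
  assumes "L2_vec \<phi>"
  shows "(\<lambda>x. \<phi> x $ j) \<in> borel_measurable borel" "integrable lborel (\<lambda>x. (\<phi> x $ j)\<^sup>2)"
proof -
  have [measurable]: "\<phi> \<in> borel_measurable borel" using assms by (simp add: L2_vec_def)
  show m [measurable]: "(\<lambda>x. \<phi> x $ j) \<in> borel_measurable borel"
    unfolding cart_eq_inner_axis by measurable
  have "integrable lborel (\<lambda>x. (norm (\<phi> x))\<^sup>2)" using assms by (simp add: L2_vec_def)
  then show "integrable lborel (\<lambda>x. (\<phi> x $ j)\<^sup>2)"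
  proof (rule Bochner_Integration.integrable_bound)
    have "(\<phi> x $ j)\<^sup>2 \<le> (norm (\<phi> x))\<^sup>2" for x
      using component_le_norm_cart[of "\<phi> x" j] by (metis abs_ge_zero power2_abs power_mono)
    then show "AE x in lborel. norm ((\<phi> x $ j)\<^sup>2) \<le> norm ((norm (\<phi> x))\<^sup>2)" by simp
  qed simp
qed

lemma norm0_sq_eq:
  assumes "L2_vec \<phi>"
  shows "norm0_sq \<phi> = (LBINT x. (norm (\<phi> x))\<^sup>2)"
  unfolding norm0_sq_def norm_vec_square using L2_vec_component(2)[OF assms]
  by (subst Bochner_Integration.integral_sum) auto

lemma L2_vec_lincomb:
  fixes \<phi> \<psi> :: "real \<Rightarrow> real ^ 'd::finite"
  assumes "L2_vec \<phi>" "L2_vec \<psi>"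
  shows "L2_vec (\<lambda>x. a *\<^sub>R \<phi> x + b *\<^sub>R \<psi> x)"
    and "norm0_sq (\<lambda>x. a *\<^sub>R \<phi> x + b *\<^sub>R \<psi> x) \<le> 2 * a\<^sup>2 * norm0_sq \<phi> + 2 * b\<^sup>2 * norm0_sq \<psi>"
proof -
  have [measurable]: "\<phi> \<in> borel_measurable borel" "\<psi> \<in> borel_measurable borel"
    and int: "integrable lborel (\<lambda>x. (norm (\<phi> x))\<^sup>2)" "integrable lborel (\<lambda>x. (norm (\<psi> x))\<^sup>2)"
    using assms by (simp_all add: L2_vec_def)
  have int2: "integrable lborel (\<lambda>x. 2 * a\<^sup>2 * (norm (\<phi> x))\<^sup>2 + 2 * b\<^sup>2 * (norm (\<psi> x))\<^sup>2)"
    using int by simp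
  then have int3: "integrable lborel (\<lambda>x. (norm (a *\<^sub>R \<phi> x + b *\<^sub>R \<psi> x))\<^sup>2)"
    by (rule Bochner_Integration.integrable_bound)
      (auto intro!: AE_I2 norm_lincomb_square_le)
  show L: "L2_vec (\<lambda>x. a *\<^sub>R \<phi> x + b *\<^sub>R \<psi> x)"
    unfolding L2_vec_def using int3 by simp
  have "norm0_sq (\<lambda>x. a *\<^sub>R \<phi> x + b *\<^sub>R \<psi> x)
      \<le> (LBINT x. 2 * a\<^sup>2 * (norm (\<phi> x))\<^sup>2 + 2 * b\<^sup>2 * (norm (\<psi> x))\<^sup>2)"
    unfolding norm0_sq_eq[OF L] by (intro integral_mono int2 int3 norm_lincomb_square_le)
  also have "\<dots> = 2 * a\<^sup>2 * norm0_sq \<phi> + 2 * b\<^sup>2 * norm0_sq \<psi>"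
    using int by (simp add: norm0_sq_eq assms)
  finally show "norm0_sq (\<lambda>x. a *\<^sub>R \<phi> x + b *\<^sub>R \<psi> x) \<le> 2 * a\<^sup>2 * norm0_sq \<phi> + 2 * b\<^sup>2 * norm0_sq \<psi>" .
qed

lemma L2_vec_diff: "L2_vec \<phi> \<Longrightarrow> L2_vec \<psi> \<Longrightarrow> L2_vec (\<lambda>x. \<phi> x - \<psi> x)"
  using L2_vec_lincomb(1)[of \<phi> \<psi> 1 "-1"] by simp

lemma norm0_sq_nonneg: "0 \<le> norm0_sq \<phi>"
  unfolding norm0_sq_def by (intro sum_nonneg integral_nonneg_AE) auto

text \<open>Continuity of the squared norm under convergence in the mean, obtained by integrating
  \<open>norm_square_diff_weighted\<close> and letting the weight depend on the index.\<close>

lemma norm0_sq_tendsto: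
  assumes "\<And>i. L2_vec (\<psi> i)" "L2_vec \<phi>"
    and "(\<lambda>i. norm0_sq (\<lambda>x. \<psi> i x - \<phi> x)) \<longlonglongrightarrow> 0"
  shows "(\<lambda>i. norm0_sq (\<psi> i)) \<longlonglongrightarrow> norm0_sq \<phi>"
proof -
  have "(\<lambda>i. norm0_sq (\<psi> i) - norm0_sq \<phi>) \<longlonglongrightarrow> 0"
  proof (rule tendsto_0_weighted_bound[OF _ norm0_sq_nonneg assms(3)])
    fix \<epsilon> :: real and i assume e: "0 < \<epsilon>"
    have L: "L2_vec (\<lambda>x. \<psi> i x - \<phi> x)" by (intro L2_vec_diff assms)
    have int: "integrable lborel (\<lambda>x. (norm (\<psi> i x))\<^sup>2)" "integrable lborel (\<lambda>x. (norm (\<phi> x))\<^sup>2)"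
        "integrable lborel (\<lambda>x. (norm (\<psi> i x - \<phi> x))\<^sup>2)"
      using assms(1)[of i] assms(2) L by (simp_all add: L2_vec_def)
    have "norm (norm0_sq (\<psi> i) - norm0_sq \<phi>) = norm (LBINT x. (norm (\<psi> i x))\<^sup>2 - (norm (\<phi> x))\<^sup>2)"
      using int by (simp add: norm0_sq_eq assms)
    also have "\<dots> \<le> (LBINT x. norm ((norm (\<psi> i x))\<^sup>2 - (norm (\<phi> x))\<^sup>2))"
      by (rule integral_norm_bound)
    also have "\<dots> \<le> (LBINT x. \<epsilon> * (norm (\<phi> x))\<^sup>2 + (1 + 1 / \<epsilon>) * (norm (\<psi> i x - \<phi> x))\<^sup>2)"
      unfolding real_norm_def
      by (intro integral_mono integrable_abs Bochner_Integration.integrable_diff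
          Bochner_Integration.integrable_add integrable_mult_right int norm_square_diff_weighted e)
    also have "\<dots> = \<epsilon> * norm0_sq \<phi> + (1 + 1 / \<epsilon>) * norm0_sq (\<lambda>x. \<psi> i x - \<phi> x)"
      using int by (simp add: norm0_sq_eq assms L)
    finally show "norm (norm0_sq (\<psi> i) - norm0_sq \<phi>)
        \<le> \<epsilon> * norm0_sq \<phi> + (1 + 1 / \<epsilon>) * norm0_sq (\<lambda>x. \<psi> i x - \<phi> x)" .
  qed
  then show ?thesis by (rule LIM_zero_cancel)
qed

lemma schwartz_vec_lincomb:
  assumes "\<phi> \<in> schwartz_vec" "\<psi> \<in> schwartz_vec"
  shows "(\<lambda>x. a *\<^sub>R \<phi> x + b *\<^sub>R \<psi> x) \<in> schwartz_vec"
  using assms by (auto simp: schwartz_vec_def intro!: schwartz_lincomb)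

lemma schwartz_vec_L2_vec:
  assumes "\<phi> \<in> schwartz_vec"
  shows "L2_vec \<phi>"
proof -
  have c: "(\<lambda>x. \<phi> x $ j) \<in> schwartz" for j using assms by (simp add: schwartz_vec_def)
  note [measurable] = schwartz_measurable[OF c]
  have "\<phi> \<in> borel_measurable borel"
    unfolding borel_measurable_euclidean_space[of \<phi>]
    by (auto simp: Basis_vec_def inner_axis)
  moreover have "integrable lborel (\<lambda>x. (norm (\<phi> x))\<^sup>2)"
    unfolding norm_vec_square by (intro Bochner_Integration.integrable_sum schwartz_square_integrable c)
  ultimately show ?thesis by (simp add: L2_vec_def)
qed

lemma pairing_lincomb:
  assumes w: "w \<in> tempered_vec" and "\<phi> \<in> schwartz_vec" "\<psi> \<in> schwartz_vec"
  shows "pairing w (\<lambda>x. a *\<^sub>R \<phi> x + b *\<^sub>R \<psi> x) = a * pairing w \<phi> + b * pairing w \<psi>"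
proof -
  have "(w $ j) (\<lambda>x. a * \<phi> x $ j + b * \<psi> x $ j) = a * (w $ j) (\<lambda>x. \<phi> x $ j) + b * (w $ j) (\<lambda>x. \<psi> x $ j)" for j
    using assms by (auto simp: tempered_vec_def tempered_def schwartz_vec_def)
  then show ?thesis by (simp add: pairing_def sum.distrib sum_distrib_left)
qed

lemma norm0_sq_scale: "norm0_sq (\<lambda>x. a *\<^sub>R \<phi> x) = a\<^sup>2 * norm0_sq \<phi>"
  by (simp add: norm0_sq_def power_mult_distrib sum_distrib_left)

lemma norm_iexp_diff_le: "norm (exp (\<i> * of_real x) - exp (\<i> * of_real y)) \<le> \<bar>x - y\<bar>"
proof -
  have "exp (\<i> * of_real x) - exp (\<i> * of_real y) = exp (\<i> * of_real y) * (exp (\<i> * of_real (x - y)) - 1)"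
    by (simp add: algebra_simps flip: exp_add)
  then show ?thesis using iexp_approx1[of "x - y" 0] by (simp add: norm_mult)
qed

section \<open>Random variables under the Mittag-Leffler measure\<close>

locale mittag_leffler_space =
  fixes \<beta> :: real and \<mu> :: "'d::finite functional_vec measure"
  assumes \<beta>: "0 < \<beta>" and ml: "mittag_leffler_measure \<beta> \<mu>"
begin

sublocale prob_space \<mu>
  using ml by (simp add: mittag_leffler_measure_def)

lemma space_mu: "space \<mu> = tempered_vec"
  and sets_mu: "sets \<mu> = sigma_sets tempered_vec cylinder_sets"
  and char_mu: "\<phi> \<in> schwartz_vec \<Longrightarrow> (LINT w|\<mu>. exp (\<i> * of_real (pairing w \<phi>)))
       = mittag_leffler \<beta> (of_real (- (norm0_sq \<phi> / 2)))"
  using ml by (simp_all add: mittag_leffler_measure_def)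

text \<open>The preimage of a Borel set is a cylinder set with a single test function,
  \<open>m = 1\<close>.\<close>

lemma pairing_measurable:
  assumes \<phi>: "\<phi> \<in> schwartz_vec"
  shows "(\<lambda>w. pairing w \<phi>) \<in> borel_measurable \<mu>"
proof (rule measurableI)
  fix A :: "real set" assume A: "A \<in> sets borel"
  let ?A = "{x \<in> space (Pi\<^sub>M {..<1::nat} (\<lambda>_. borel)). x 0 \<in> A}"
  have "?A \<in> sets (Pi\<^sub>M {..<1::nat} (\<lambda>_. borel))"
    using A by (intro measurable_sets_Collect[OF measurable_component_singleton[of 0]]) auto
  then have "{w \<in> tempered_vec. (\<lambda>i\<in>{..<1::nat}. pairing w \<phi>) \<in> ?A} \<in> cylinder_sets"
    unfolding cylinder_sets_def mem_Collect_eq using \<phi>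
    by (intro exI[of _ "1::nat"] exI[of _ "\<lambda>_. \<phi>"] exI[of _ ?A]) simp
  moreover have "(\<lambda>w. pairing w \<phi>) -` A \<inter> space \<mu> = {w \<in> tempered_vec. (\<lambda>i\<in>{..<1::nat}. pairing w \<phi>) \<in> ?A}"
    by (auto simp: space_mu space_PiM)
  ultimately show "(\<lambda>w. pairing w \<phi>) -` A \<inter> space \<mu> \<in> sets \<mu>"
    unfolding sets_mu by (simp add: sigma_sets.Basic)
qed simp

text \<open>Inserting \<open>u *\<^sub>R \<phi>\<close> into the characteristic functional gives the
  characteristic function of the pairing at \<open>u\<close>. Linearity of the pairing is available
  because the measure lives on \<open>tempered_vec\<close>.\<close>

lemma pairing_second_moment:
  assumes \<phi>: "\<phi> \<in> schwartz_vec"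
  shows "has_bochner_integral \<mu> (\<lambda>w. (pairing w \<phi>)\<^sup>2) (norm0_sq \<phi> / Gamma (\<beta> + 1))"
proof (rule mittag_leffler_char_second_moment[OF pairing_measurable[OF \<phi>] norm0_sq_nonneg \<beta>])
  fix u :: real
  have u: "(\<lambda>x. u *\<^sub>R \<phi> x) \<in> schwartz_vec"
    using schwartz_vec_lincomb[OF \<phi> \<phi>, of u 0] by simp
  have "pairing w (\<lambda>x. u *\<^sub>R \<phi> x) = u * pairing w \<phi>" if "w \<in> space \<mu>" for w
    using pairing_lincomb[OF _ \<phi> \<phi>, of w u 0] that by (simp add: space_mu)
  then have "(LINT w|\<mu>. exp (\<i> * of_real (u * pairing w \<phi>)))
      = (LINT w|\<mu>. exp (\<i> * of_real (pairing w (\<lambda>x. u *\<^sub>R \<phi> x))))"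
    by (intro Bochner_Integration.integral_cong) auto
  then show "(LINT w|\<mu>. exp (\<i> * of_real (u * pairing w \<phi>)))
      = mittag_leffler \<beta> (of_real (- (u\<^sup>2 * norm0_sq \<phi> / 2)))"
    unfolding char_mu[OF u] norm0_sq_scale .
qed

end

lemma lincomb_square_integral:
  fixes X Y :: "'a \<Rightarrow> real"
  assumes [measurable]: "X \<in> borel_measurable M" "Y \<in> borel_measurable M"
    and int: "integrable M (\<lambda>w. (X w)\<^sup>2)" "integrable M (\<lambda>w. (Y w)\<^sup>2)"
  shows "integrable M (\<lambda>w. (a * X w + b * Y w)\<^sup>2)"
    and "(LINT w|M. (a * X w + b * Y w)\<^sup>2) \<le> 2 * a\<^sup>2 * (LINT w|M. (X w)\<^sup>2) + 2 * b\<^sup>2 * (LINT w|M. (Y w)\<^sup>2)"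
proof -
  have le: "(a * X w + b * Y w)\<^sup>2 \<le> 2 * a\<^sup>2 * (X w)\<^sup>2 + 2 * b\<^sup>2 * (Y w)\<^sup>2" for w
    using norm_lincomb_square_le[of a "X w" b "Y w"] by simp
  have int2: "integrable M (\<lambda>w. 2 * a\<^sup>2 * (X w)\<^sup>2 + 2 * b\<^sup>2 * (Y w)\<^sup>2)" using int by simp
  then show int3: "integrable M (\<lambda>w. (a * X w + b * Y w)\<^sup>2)"
    by (rule Bochner_Integration.integrable_bound) (auto intro!: AE_I2 le)
  have "(LINT w|M. (a * X w + b * Y w)\<^sup>2) \<le> (LINT w|M. 2 * a\<^sup>2 * (X w)\<^sup>2 + 2 * b\<^sup>2 * (Y w)\<^sup>2)"
    by (intro integral_mono int2 int3 le)
  also have "\<dots> = 2 * a\<^sup>2 * (LINT w|M. (X w)\<^sup>2) + 2 * b\<^sup>2 * (LINT w|M. (Y w)\<^sup>2)"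
    using int by simp
  finally show "(LINT w|M. (a * X w + b * Y w)\<^sup>2) \<le> 2 * a\<^sup>2 * (LINT w|M. (X w)\<^sup>2) + 2 * b\<^sup>2 * (LINT w|M. (Y w)\<^sup>2)" .
qed

lemma tendsto_0_lincomb_bound:
  fixes A B C :: "nat \<Rightarrow> real"
  assumes "A \<longlonglongrightarrow> 0" "B \<longlonglongrightarrow> 0" "\<And>i. 0 \<le> C i" "\<And>i. C i \<le> a * A i + b * B i"
  shows "C \<longlonglongrightarrow> 0"
proof (rule Lim_null_comparison)
  show "\<forall>\<^sub>F i in sequentially. norm (C i) \<le> a * A i + b * B i"
    using assms(3,4) by (intro always_eventually allI) simp
  have "(\<lambda>i. a * A i + b * B i) \<longlonglongrightarrow> a * 0 + b * 0"
    by (intro tendsto_intros assms)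
  then show "(\<lambda>i. a * A i + b * B i) \<longlonglongrightarrow> 0" by simp
qed

context mittag_leffler_space begin

text \<open>The convergence in \<open>L2_pairing\<close> concerns Bochner integrals, which are 0 for
  functions that are not integrable. This shows that they are genuine squared distances.\<close>

lemma pairing_diff_square_integrable:
  assumes \<psi>: "\<psi> \<in> schwartz_vec" and X: "X \<in> borel_measurable \<mu>" "integrable \<mu> (\<lambda>w. (X w)\<^sup>2)"
  shows "integrable \<mu> (\<lambda>w. (pairing w \<psi> - X w)\<^sup>2)"
  using lincomb_square_integral(1)[OF pairing_measurable[OF \<psi>] X(1)
      integrable.intros[OF pairing_second_moment[OF \<psi>]] X(2), of 1 "-1"]
  by simp

text \<open>The same combination of the approximating Schwartz sequences approximates in both
  spaces, by the inequality \<open>(a * x + b * y)\<^sup>2 \<le> 2 * a\<^sup>2 * x\<^sup>2 + 2 *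
  b\<^sup>2 * y\<^sup>2\<close>.\<close>

lemma L2_pairing_lincomb:
  assumes "L2_pairing \<mu> \<phi> X" "L2_pairing \<mu> \<phi>' X'"
  shows "L2_pairing \<mu> (\<lambda>x. a *\<^sub>R \<phi> x + b *\<^sub>R \<phi>' x) (\<lambda>w. a * X w + b * X' w)"
proof -
  have L: "L2_vec \<phi>" "L2_vec \<phi>'" and X [measurable]: "X \<in> borel_measurable \<mu>" "X' \<in> borel_measurable \<mu>"
    and Xi: "integrable \<mu> (\<lambda>w. (X w)\<^sup>2)" "integrable \<mu> (\<lambda>w. (X' w)\<^sup>2)"
    using assms by (simp_all add: L2_pairing_def L2_vec_def)
  obtain \<psi> where \<psi>: "\<And>i. \<psi> i \<in> schwartz_vec" "(\<lambda>i. norm0_sq (\<lambda>x. \<psi> i x - \<phi> x)) \<longlonglongrightarrow> 0"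
      "(\<lambda>i. LINT w|\<mu>. (pairing w (\<psi> i) - X w)\<^sup>2) \<longlonglongrightarrow> 0"
    using assms(1) unfolding L2_pairing_def by blast
  obtain \<psi>' where \<psi>': "\<And>i. \<psi>' i \<in> schwartz_vec" "(\<lambda>i. norm0_sq (\<lambda>x. \<psi>' i x - \<phi>' x)) \<longlonglongrightarrow> 0"
      "(\<lambda>i. LINT w|\<mu>. (pairing w (\<psi>' i) - X' w)\<^sup>2) \<longlonglongrightarrow> 0"
    using assms(2) unfolding L2_pairing_def by blast
  let ?\<psi> = "\<lambda>i x. a *\<^sub>R \<psi> i x + b *\<^sub>R \<psi>' i x"
  let ?\<phi> = "\<lambda>x. a *\<^sub>R \<phi> x + b *\<^sub>R \<phi>' x"
  have "(\<lambda>i. norm0_sq (\<lambda>x. ?\<psi> i x - ?\<phi> x)) \<longlonglongrightarrow> 0"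
  proof (rule tendsto_0_lincomb_bound[OF \<psi>(2) \<psi>'(2) norm0_sq_nonneg])
    fix i
    have "(\<lambda>x. ?\<psi> i x - ?\<phi> x) = (\<lambda>x. a *\<^sub>R (\<psi> i x - \<phi> x) + b *\<^sub>R (\<psi>' i x - \<phi>' x))"
      by (simp add: fun_eq_iff algebra_simps)
    then show "norm0_sq (\<lambda>x. ?\<psi> i x - ?\<phi> x)
        \<le> 2 * a\<^sup>2 * norm0_sq (\<lambda>x. \<psi> i x - \<phi> x) + 2 * b\<^sup>2 * norm0_sq (\<lambda>x. \<psi>' i x - \<phi>' x)"
      using L2_vec_lincomb(2)[of "\<lambda>x. \<psi> i x - \<phi> x" "\<lambda>x. \<psi>' i x - \<phi>' x" a b]
      by (simp only:) (simp add: L2_vec_diff L schwartz_vec_L2_vec \<psi>(1) \<psi>'(1))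
  qed
  moreover have "(\<lambda>i. LINT w|\<mu>. (pairing w (?\<psi> i) - (a * X w + b * X' w))\<^sup>2) \<longlonglongrightarrow> 0"
  proof (rule tendsto_0_lincomb_bound[OF \<psi>(3) \<psi>'(3)])
    fix i
    note [measurable] = pairing_measurable[OF \<psi>(1)] pairing_measurable[OF \<psi>'(1)]
    have "(LINT w|\<mu>. (pairing w (?\<psi> i) - (a * X w + b * X' w))\<^sup>2)
        = (LINT w|\<mu>. (a * (pairing w (\<psi> i) - X w) + b * (pairing w (\<psi>' i) - X' w))\<^sup>2)"
      by (intro Bochner_Integration.integral_cong refl)
        (simp add: space_mu pairing_lincomb \<psi>(1) \<psi>'(1) algebra_simps)
    also have "\<dots> \<le> 2 * a\<^sup>2 * (LINT w|\<mu>. (pairing w (\<psi> i) - X w)\<^sup>2)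
        + 2 * b\<^sup>2 * (LINT w|\<mu>. (pairing w (\<psi>' i) - X' w)\<^sup>2)"
      by (intro lincomb_square_integral(2) pairing_diff_square_integrable \<psi>(1) \<psi>'(1) X Xi) measurable
    finally show "(LINT w|\<mu>. (pairing w (?\<psi> i) - (a * X w + b * X' w))\<^sup>2)
        \<le> 2 * a\<^sup>2 * (LINT w|\<mu>. (pairing w (\<psi> i) - X w)\<^sup>2)
        + 2 * b\<^sup>2 * (LINT w|\<mu>. (pairing w (\<psi>' i) - X' w)\<^sup>2)" .
  qed simp
  moreover have "\<forall>i. ?\<psi> i \<in> schwartz_vec" by (intro allI schwartz_vec_lincomb \<psi>(1) \<psi>'(1))
  moreover have "L2_vec ?\<phi>" by (intro L2_vec_lincomb(1) L)
  moreover have "integrable \<mu> (\<lambda>w. (a * X w + b * X' w)\<^sup>2)" by (intro lincomb_square_integral(1) X Xi)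
  ultimately show ?thesis
    unfolding L2_pairing_def L2_vec_def by (intro conjI exI[of _ ?\<psi>]) simp_all
qed

lemma L2_pairing_zero: "L2_pairing \<mu> (\<lambda>x. 0) (\<lambda>w. 0)"
proof -
  have z: "(\<lambda>x. 0) \<in> (schwartz_vec :: (real \<Rightarrow> real ^ 'd) set)" by (simp add: schwartz_vec_def schwartz_zero)
  have "pairing w (\<lambda>x. 0) = 0" if "w \<in> space \<mu>" for w
    using pairing_lincomb[OF _ z z, of w 0 0] that by (simp add: space_mu)
  then have "(LINT w|\<mu>. (pairing w (\<lambda>x. 0) - 0)\<^sup>2) = (LINT w|\<mu>. 0)"
    by (intro Bochner_Integration.integral_cong) auto
  then show ?thesis
    unfolding L2_pairing_def using z
    by (intro conjI exI[of _ "\<lambda>i x. 0"]) (simp_all add: norm0_sq_def)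
qed

lemma L2_pairing_scale: "L2_pairing \<mu> \<phi> X \<Longrightarrow> L2_pairing \<mu> (\<lambda>x. a *\<^sub>R \<phi> x) (\<lambda>w. a * X w)"
  using L2_pairing_lincomb[of \<phi> X \<phi> X a 0] by simp

lemma L2_pairing_sum:
  assumes "finite I" "\<And>i. i \<in> I \<Longrightarrow> L2_pairing \<mu> (\<phi> i) (X i)"
  shows "L2_pairing \<mu> (\<lambda>x. \<Sum>i\<in>I. \<phi> i x) (\<lambda>w. \<Sum>i\<in>I. X i w)"
  using assms
proof (induction I rule: finite_induct)
  case (insert i I)
  then show ?case
    using L2_pairing_lincomb[of "\<phi> i" "X i" "\<lambda>x. \<Sum>i\<in>I. \<phi> i x" "\<lambda>w. \<Sum>i\<in>I. X i w" 1 1] by simp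
qed (simp add: L2_pairing_zero)

text \<open>On the left, \<open>\<bar>exp(ix) - exp(iy)\<bar> \<le> \<bar>x - y\<bar>\<close> and
  convergence in the mean square pass to the limit; on the right, the squared norms converge. The
  bound \<open>small\<close> places the limiting argument in the disc where
  \<open>mittag_leffler\<close> is known to be continuous.\<close>

lemma L2_pairing_char:
  assumes X: "L2_pairing \<mu> \<phi> X" and small: "norm0_sq \<phi> \<le> 1"
  shows "(LINT w|\<mu>. exp (\<i> * of_real (X w))) = mittag_leffler \<beta> (of_real (- (norm0_sq \<phi> / 2)))"
proof -
  have L: "L2_vec \<phi>" and Xm [measurable]: "X \<in> borel_measurable \<mu>" and Xi: "integrable \<mu> (\<lambda>w. (X w)\<^sup>2)"
    using X by (simp_all add: L2_pairing_def L2_vec_def)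
  obtain \<psi> where \<psi>: "\<And>i. \<psi> i \<in> schwartz_vec" "(\<lambda>i. norm0_sq (\<lambda>x. \<psi> i x - \<phi> x)) \<longlonglongrightarrow> 0"
      "(\<lambda>i. LINT w|\<mu>. (pairing w (\<psi> i) - X w)\<^sup>2) \<longlonglongrightarrow> 0"
    using X unfolding L2_pairing_def by blast
  note [measurable] = pairing_measurable[OF \<psi>(1)]
  let ?e = "\<lambda>i w. exp (\<i> * complex_of_real (pairing w (\<psi> i)))"
  let ?eX = "\<lambda>w. exp (\<i> * complex_of_real (X w))"
  have ei: "integrable \<mu> (?e i)" "integrable \<mu> ?eX" for i
    by (intro integrable_iexp; simp)+
  have "(\<lambda>i. (LINT w|\<mu>. ?e i w) - (LINT w|\<mu>. ?eX w)) \<longlonglongrightarrow> 0"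
  proof (rule tendsto_0_weighted_bound[OF _ _ \<psi>(3)])
    fix \<epsilon> :: real and i assume e: "0 < \<epsilon>"
    have int: "integrable \<mu> (\<lambda>w. (pairing w (\<psi> i) - X w)\<^sup>2)"
      by (intro pairing_diff_square_integrable \<psi>(1) Xm Xi)
    have "norm ((LINT w|\<mu>. ?e i w) - (LINT w|\<mu>. ?eX w)) = norm (LINT w|\<mu>. ?e i w - ?eX w)"
      using ei by simp
    also have "\<dots> \<le> (LINT w|\<mu>. norm (?e i w - ?eX w))"
      by (rule integral_norm_bound)
    also have "\<dots> \<le> (LINT w|\<mu>. \<epsilon> + (1 + 1 / \<epsilon>) * (pairing w (\<psi> i) - X w)\<^sup>2)"
      by (intro integral_mono integrable_norm Bochner_Integration.integrable_diff ei
          Bochner_Integration.integrable_add integrable_const integrable_mult_right int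
          order_trans[OF norm_iexp_diff_le abs_le_weighted_square[OF e]])
    also have "\<dots> = \<epsilon> * 1 + (1 + 1 / \<epsilon>) * (LINT w|\<mu>. (pairing w (\<psi> i) - X w)\<^sup>2)"
      using int by (simp add: prob_space)
    finally show "norm ((LINT w|\<mu>. ?e i w) - (LINT w|\<mu>. ?eX w))
        \<le> \<epsilon> * 1 + (1 + 1 / \<epsilon>) * (LINT w|\<mu>. (pairing w (\<psi> i) - X w)\<^sup>2)" .
  qed simp
  then have 1: "(\<lambda>i. LINT w|\<mu>. ?e i w) \<longlonglongrightarrow> (LINT w|\<mu>. ?eX w)" by (rule LIM_zero_cancel)
  have "(\<lambda>i. norm0_sq (\<psi> i)) \<longlonglongrightarrow> norm0_sq \<phi>"
    by (intro norm0_sq_tendsto schwartz_vec_L2_vec \<psi> L)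
  then have "(\<lambda>i. complex_of_real (- (norm0_sq (\<psi> i) / 2))) \<longlonglongrightarrow> of_real (- (norm0_sq \<phi> / 2))"
    by (intro tendsto_intros) simp_all
  moreover have "isCont (mittag_leffler \<beta>) (of_real (- (norm0_sq \<phi> / 2)))"
    using \<beta> small norm0_sq_nonneg[of \<phi>] by (intro mittag_leffler_isCont; simp only: norm_of_real)
  ultimately have 2: "(\<lambda>i. mittag_leffler \<beta> (of_real (- (norm0_sq (\<psi> i) / 2))))
      \<longlonglongrightarrow> mittag_leffler \<beta> (of_real (- (norm0_sq \<phi> / 2)))"
    by (rule isCont_tendsto_compose[rotated])
  show ?thesis
    using LIMSEQ_unique[OF 1] 2 unfolding char_mu[OF \<psi>(1)] by simp
qed

text \<open>The moment is read off from the characteristic function of \<open>X\<close> itself;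
  rescaling by \<open>u\<close> turns the smallness condition into the one on
  \<open>u\<close>.\<close>

lemma L2_pairing_second_moment:
  assumes X: "L2_pairing \<mu> \<phi> X"
  shows "has_bochner_integral \<mu> (\<lambda>w. (X w)\<^sup>2) (norm0_sq \<phi> / Gamma (\<beta> + 1))"
proof (rule mittag_leffler_char_second_moment[OF _ norm0_sq_nonneg \<beta>])
  show "X \<in> borel_measurable \<mu>" using X by (simp add: L2_pairing_def)
  show "(LINT w|\<mu>. exp (\<i> * of_real (u * X w))) = mittag_leffler \<beta> (of_real (- (u\<^sup>2 * norm0_sq \<phi> / 2)))"
    if "u\<^sup>2 * norm0_sq \<phi> \<le> 1" for u
    using L2_pairing_char[OF L2_pairing_scale[OF X, of u]] that unfolding norm0_sq_scale .
qed

end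

section \<open>Generalized grey Brownian motion\<close>

lemma mittag_leffler_measurable [measurable]: "mittag_leffler \<beta> \<in> borel_measurable borel"
  unfolding mittag_leffler_def by measurable

lemma norm0_sq_scaleR: "norm0_sq (\<lambda>x. f x *\<^sub>R k) = (norm k)\<^sup>2 * (LBINT x. (f x)\<^sup>2)"
  unfolding norm_vec_square sum_distrib_right
  by (simp add: norm0_sq_def power_mult_distrib mult.commute)

lemma axis_scaleR: "axis j a = a *\<^sub>R (axis j 1 :: real ^ 'd::finite)"
  by (simp add: vec_eq_iff axis_def)

locale ggBm_process = mittag_leffler_space \<beta> \<mu>
  for \<beta> and \<mu> :: "'d::finite functional_vec measure" +
  fixes \<alpha> :: real and B :: "real \<Rightarrow> 'd functional_vec \<Rightarrow> real ^ 'd"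
  assumes \<alpha>: "0 < \<alpha>" "\<alpha> < 2" and B: "ggBm \<alpha> \<mu> B"
begin

abbreviation M1 :: "real \<Rightarrow> real \<Rightarrow> real" where
  "M1 t \<equiv> M_minus \<alpha> (indicator {0..<t})"

lemma B_pairing: "0 \<le> t \<Longrightarrow> L2_pairing \<mu> (\<lambda>x. axis j (M1 t x)) (\<lambda>w. B t w $ j)"
  using B by (simp add: ggBm_def)

text \<open>Measurability is part of \<open>L2_pairing\<close> and is extracted from a coordinate of
  the vector-valued function.\<close>

lemma M1_measurable [measurable]: "0 \<le> t \<Longrightarrow> M1 t \<in> borel_measurable borel"
proof -
  assume "0 \<le> t"
  then have "L2_vec (\<lambda>x. axis j (M1 t x) :: real ^ 'd)" for j
    using B_pairing by (auto simp: L2_pairing_def L2_vec_def)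
  from L2_vec_component(1)[OF this, of j j for j] show ?thesis by simp
qed

lemma M1_increment:
  assumes "0 \<le> s" "0 \<le> t"
  shows "(LBINT x. (M1 t x - M1 s x)\<^sup>2) = \<bar>t - s\<bar> powr \<alpha>"
  using M_minus_increment[OF \<alpha> assms M1_measurable[OF assms(2)] M1_measurable[OF assms(1)]]
  by (rule has_bochner_integral_integral_eq)

lemma M1_square: "0 \<le> t \<Longrightarrow> (LBINT x. (M1 t x)\<^sup>2) = t powr \<alpha>"
proof -
  have "indicator {0..<0} = (\<lambda>x::real. 0::real)" by (simp add: fun_eq_iff)
  then have "M1 0 = (\<lambda>x. 0)" using M_minus_zero[of \<alpha>] by (simp only:)
  then show "0 \<le> t \<Longrightarrow> (LBINT x. (M1 t x)\<^sup>2) = t powr \<alpha>"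
    using M1_increment[of 0 t] by (simp del: atLeastLessThan_empty_iff atLeastLessThan_empty)
qed

text \<open>The process is given coordinate by coordinate; linearity assembles the
  \<open>2 * d\<close> pairings into a single one, to which the scalar results apply.\<close>

lemma increment_pairing:
  assumes "0 \<le> s" "0 \<le> t"
  shows "L2_pairing \<mu> (\<lambda>x. (M1 t x - M1 s x) *\<^sub>R k) (\<lambda>w. k \<bullet> (B t w - B s w))"
proof -
  have "L2_pairing \<mu> (\<lambda>x. \<Sum>j\<in>UNIV. (k $ j) *\<^sub>R axis j (M1 t x) + (- (k $ j)) *\<^sub>R axis j (M1 s x))
      (\<lambda>w. \<Sum>j\<in>UNIV. k $ j * B t w $ j + (- (k $ j)) * B s w $ j)"
    by (intro L2_pairing_sum L2_pairing_lincomb B_pairing assms) simp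
  moreover have "(\<Sum>j\<in>UNIV. (k $ j) *\<^sub>R axis j (M1 t x) + (- (k $ j)) *\<^sub>R axis j (M1 s x))
      = (M1 t x - M1 s x) *\<^sub>R k" for x
    by (simp add: vec_eq_iff axis_def if_distrib[of "(*) _"] sum_subtractf algebra_simps cong: if_cong)
  moreover have "(\<Sum>j\<in>UNIV. k $ j * B t w $ j + (- (k $ j)) * B s w $ j) = k \<bullet> (B t w - B s w)" for w
    by (simp add: inner_vec_def algebra_simps)
  ultimately show ?thesis by simp
qed

lemma increment_norm0_sq:
  assumes "0 \<le> s" "0 \<le> t"
  shows "norm0_sq (\<lambda>x. (M1 t x - M1 s x) *\<^sub>R k) = (norm k)\<^sup>2 * \<bar>t - s\<bar> powr \<alpha>"
  unfolding norm0_sq_scaleR M1_increment[OF assms] ..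

lemma increment_char:
  assumes "0 \<le> s" "0 \<le> t" "(norm k)\<^sup>2 * \<bar>t - s\<bar> powr \<alpha> \<le> 1"
  shows "(LINT w|\<mu>. exp (\<i> * of_real (k \<bullet> (B t w - B s w))))
    = mittag_leffler \<beta> (of_real (- ((norm k)\<^sup>2 * \<bar>t - s\<bar> powr \<alpha> / 2)))"
  using L2_pairing_char[OF increment_pairing[OF assms(1,2), of k]] assms(3)
  unfolding increment_norm0_sq[OF assms(1,2)] .

lemma norm_square_moment:
  fixes Y :: "'d functional_vec \<Rightarrow> real ^ 'd"
  assumes "\<And>j. has_bochner_integral \<mu> (\<lambda>w. (Y w $ j)\<^sup>2) c"
  shows "(LINT w|\<mu>. (norm (Y w))\<^sup>2) = real CARD('d) * c"
  unfolding norm_vec_square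
  using has_bochner_integral_sum[of UNIV \<mu> "\<lambda>j w. (Y w $ j)\<^sup>2" "\<lambda>_. c"] assms
  by (auto dest: has_bochner_integral_integral_eq)

lemma increment_second_moment:
  assumes "0 \<le> s" "0 \<le> t"
  shows "(LINT w|\<mu>. (norm (B t w - B s w))\<^sup>2) = real CARD('d) * (\<bar>t - s\<bar> powr \<alpha> / Gamma (\<beta> + 1))"
proof (rule norm_square_moment)
  fix j
  show "has_bochner_integral \<mu> (\<lambda>w. ((B t w - B s w) $ j)\<^sup>2) (\<bar>t - s\<bar> powr \<alpha> / Gamma (\<beta> + 1))"
    using L2_pairing_second_moment[OF increment_pairing[OF assms, of "axis j 1"]]
    unfolding increment_norm0_sq[OF assms] by (simp add: inner_axis')
qed

lemma second_moment:
  assumes "0 \<le> t"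
  shows "(LINT w|\<mu>. (norm (B t w))\<^sup>2) = real CARD('d) * (t powr \<alpha> / Gamma (\<beta> + 1))"
proof (rule norm_square_moment)
  fix j
  have "norm0_sq (\<lambda>x. axis j (M1 t x) :: real ^ 'd) = t powr \<alpha>"
    unfolding axis_scaleR[of j "M1 t _"] norm0_sq_scaleR M1_square[OF assms] by simp
  then show "has_bochner_integral \<mu> (\<lambda>w. (B t w $ j)\<^sup>2) (t powr \<alpha> / Gamma (\<beta> + 1))"
    using L2_pairing_second_moment[OF B_pairing[OF assms, of j]] by simp
qed

section \<open>End-to-end length, radius of gyration and form factor\<close>

lemma end_to_end_length:
  "end_to_end_length_sq \<mu> B n = real CARD('d) * (real n powr \<alpha> / Gamma (\<beta> + 1))"
  using increment_second_moment[of 0 "real n"] by (simp add: end_to_end_length_sq_def)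

lemma gyration_radius:
  assumes n: "1 \<le> n"
  shows "gyration_radius_sq \<mu> B n
    = real CARD('d) * (real n powr \<alpha> / (Gamma (\<beta> + 1) * (\<alpha> + 1) * (\<alpha> + 2)))"
proof -
  let ?c = "real CARD('d) / Gamma (\<beta> + 1)"
  have "(LBINT t:{0..real n}. LBINT s:{0..real n}. LINT w|\<mu>. (norm (B t w - B s w))\<^sup>2)
      = (LBINT t:{0..real n}. LBINT s:{0..real n}. ?c * \<bar>t - s\<bar> powr \<alpha>)"
    by (intro set_lebesgue_integral_cong allI impI) (auto simp: increment_second_moment)
  also have "\<dots> = ?c * (2 * real n powr (\<alpha> + 2) / ((\<alpha> + 1) * (\<alpha> + 2)))"
    unfolding set_integral_mult_right abs_powr_diff_double_integral[OF \<alpha>(1) of_nat_0_le_iff] ..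
  also have "real n powr (\<alpha> + 2) = real n powr \<alpha> * (real n)\<^sup>2"
    using n by (simp add: powr_add)
  finally show ?thesis
    unfolding gyration_radius_sq_def using n by (simp add: mult_ac)
qed

text \<open>The condition on \<open>k\<close> makes the argument of \<open>mittag_leffler\<close> at
  most 1/2 in modulus for all times in [0,n] at once. One constant then controls the remainder, of
  order \<open>\<bar>k\<bar>^4\<close>, over the whole square, and only the linear term has to be
  integrated exactly.\<close>

lemma form_factor_bound:
  assumes n: "1 \<le> n"
  shows "\<exists>A\<ge>0. \<forall>k. (norm k)\<^sup>2 * real n powr \<alpha> \<le> 1 \<longrightarrow>
    norm (form_factor \<mu> B n k
      - of_real (1 - real n powr \<alpha> / (Gamma (\<beta> + 1) * (\<alpha> + 1) * (\<alpha> + 2)) * (norm k)\<^sup>2))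
    \<le> A * (norm k)\<^sup>2 * (norm k)\<^sup>2"
proof -
  define N where "N = real n"
  have N: "0 < N" using n by (simp add: N_def)
  obtain C where C: "0 \<le> C" "\<And>z. norm z \<le> 1/2 \<Longrightarrow>
      norm (mittag_leffler \<beta> z - (1 + z / of_real (Gamma (\<beta> + 1)))) \<le> C * (norm z)\<^sup>2"
    using mittag_leffler_second_order[of \<beta>] \<beta> by auto
  have G: "0 < Gamma (\<beta> + 1)" using \<beta> by (intro Gamma_real_pos) auto
  have "norm (form_factor \<mu> B n k
      - of_real (1 - N powr \<alpha> / (Gamma (\<beta> + 1) * (\<alpha> + 1) * (\<alpha> + 2)) * (norm k)\<^sup>2))
    \<le> C * (N powr \<alpha>)\<^sup>2 / 4 * (norm k)\<^sup>2 * (norm k)\<^sup>2" if k: "(norm k)\<^sup>2 * N powr \<alpha> \<le> 1" for k :: "real ^ 'd"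
  proof -
    define K where "K = (norm k)\<^sup>2"
    define z where "z = (\<lambda>t s. - (K * \<bar>t - s\<bar> powr \<alpha> / 2))"
    define f where "f = (\<lambda>t s. mittag_leffler \<beta> (of_real (z t s)))"
    define g where "g = (\<lambda>t s. complex_of_real (1 + z t s / Gamma (\<beta> + 1)))"
    define \<delta> where "\<delta> = C * (N powr \<alpha>)\<^sup>2 / 4 * K * K"
    have K: "0 \<le> K" by (simp add: K_def)
    have pw: "K * \<bar>t - s\<bar> powr \<alpha> \<le> K * N powr \<alpha>" if "t \<in> {0..N}" "s \<in> {0..N}" for t s
      using that \<alpha> K by (intro mult_left_mono powr_mono2) auto
    have z: "\<bar>z t s\<bar> \<le> K * N powr \<alpha> / 2" "\<bar>z t s\<bar> \<le> 1/2" if "t \<in> {0..N}" "s \<in> {0..N}" for t s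
      using pw[OF that] k K unfolding z_def K_def[symmetric] by (auto simp: abs_mult)
    have diff: "norm (f t s - g t s) \<le> \<delta>" if "t \<in> {0..N}" "s \<in> {0..N}" for t s
    proof -
      have "norm (f t s - g t s) \<le> C * \<bar>z t s\<bar>\<^sup>2"
        using C(2)[of "of_real (z t s)"] z(2)[OF that] unfolding f_def g_def norm_of_real by simp
      also have "\<dots> \<le> C * (K * N powr \<alpha> / 2)\<^sup>2"
        using C(1) z(1)[OF that] by (intro mult_left_mono power_mono) auto
      also have "\<dots> = \<delta>" by (simp add: \<delta>_def power2_eq_square)
      finally show ?thesis .
    qed
    have gb: "norm (g t s) \<le> 1 + 1 / Gamma (\<beta> + 1)" if "t \<in> {0..N}" "s \<in> {0..N}" for t s
    proof -
      have "\<bar>z t s / Gamma (\<beta> + 1)\<bar> \<le> 1 / Gamma (\<beta> + 1)"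
        using z(2)[OF that] G by (simp add: abs_divide divide_right_mono)
      then show ?thesis unfolding g_def norm_of_real by linarith
    qed
    \<comment> \<open>Boundedness of \<open>f\<close> follows from that of its approximation
      \<open>g\<close>; it provides the integrability needed to subtract the double
      integrals.\<close>
    have fb: "norm (f t s) \<le> 1 + 1 / Gamma (\<beta> + 1) + \<delta>" if "t \<in> {0..N}" "s \<in> {0..N}" for t s
      using norm_triangle_sub[of "f t s" "g t s"] gb[OF that] diff[OF that] by linarith
    have ff: "form_factor \<mu> B n k = 1 / (of_real N)\<^sup>2 * (LBINT t:{0..N}. LBINT s:{0..N}. f t s)"
    proof -
      have "(LINT w|\<mu>. exp (\<i> * of_real (k \<bullet> (B t w - B s w)))) = f t s"
        if "t \<in> {0..N}" "s \<in> {0..N}" for t s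
        unfolding f_def z_def K_def using pw[OF that] k that
        by (intro increment_char) (auto simp: K_def)
      then have "(LBINT t:{0..N}. LBINT s:{0..N}. LINT w|\<mu>. exp (\<i> * of_real (k \<bullet> (B t w - B s w))))
          = (LBINT t:{0..N}. LBINT s:{0..N}. f t s)"
        by (intro set_lebesgue_integral_cong allI impI) auto
      then show ?thesis by (simp add: form_factor_def N_def)
    qed
    have gg: "1 / (of_real N)\<^sup>2 * (LBINT t:{0..N}. LBINT s:{0..N}. g t s)
        = of_real (1 - N powr \<alpha> / (Gamma (\<beta> + 1) * (\<alpha> + 1) * (\<alpha> + 2)) * K)"
    proof -
      let ?c = "- (K / (2 * Gamma (\<beta> + 1)))"
      have zi: "1 + z t s / Gamma (\<beta> + 1) = 1 + ?c * \<bar>t - s\<bar> powr \<alpha>" for t s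
        by (simp add: z_def)
      have pi1: "set_integrable lborel {0..N} (\<lambda>s. \<bar>t - s\<bar> powr \<alpha>)"
        and pi2: "norm (LBINT s:{0..N}. \<bar>t - s\<bar> powr \<alpha>) \<le> N powr \<alpha> * N" if "t \<in> {0..N}" for t
        by (rule set_integral_bounded_Icc[of _ N "N powr \<alpha>"];
            use that N \<alpha> in \<open>auto intro!: powr_mono2\<close>)+
      have [measurable]: "(\<lambda>t. LBINT s:{0..N}. \<bar>t - s\<bar> powr \<alpha>) \<in> borel_measurable borel"
        unfolding set_lebesgue_integral_def by measurable
      have pi3: "set_integrable lborel {0..N} (\<lambda>t. LBINT s:{0..N}. \<bar>t - s\<bar> powr \<alpha>)"
        by (rule set_integral_bounded_Icc(1)[OF _ pi2]) (use N in auto)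
      have c1: "set_integrable lborel {0..N} (\<lambda>s. c)" "(LBINT s:{0..N}. c) = N * c" for c :: real
        using N by (auto simp: set_integrable_def set_lebesgue_integral_def)
      have "(LBINT t:{0..N}. LBINT s:{0..N}. 1 + z t s / Gamma (\<beta> + 1))
          = (LBINT t:{0..N}. N * 1 + ?c * (LBINT s:{0..N}. \<bar>t - s\<bar> powr \<alpha>))"
        unfolding zi
        by (intro set_lebesgue_integral_cong allI impI)
          (simp_all only: set_integral_add(2)[OF c1(1) set_integrable_mult_right] pi1 c1(2) set_integral_mult_right, simp_all)
      also have "\<dots> = N * (N * 1) + ?c * (2 * N powr (\<alpha> + 2) / ((\<alpha> + 1) * (\<alpha> + 2)))"
        using N by (simp only: set_integral_add(2)[OF c1(1) set_integrable_mult_right] pi3 c1(2) set_integral_mult_right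
            abs_powr_diff_double_integral[OF \<alpha>(1) less_imp_le])
      also have "N powr (\<alpha> + 2) = N powr \<alpha> * N\<^sup>2" using N by (simp add: powr_add)
      finally have r: "(LBINT t:{0..N}. LBINT s:{0..N}. 1 + z t s / Gamma (\<beta> + 1))
          = N * N + ?c * (2 * (N powr \<alpha> * N\<^sup>2) / ((\<alpha> + 1) * (\<alpha> + 2)))" by simp
      have "1 / (of_real N)\<^sup>2 * (LBINT t:{0..N}. LBINT s:{0..N}. g t s)
        = complex_of_real (1 / N\<^sup>2 * (N * N + ?c * (2 * (N powr \<alpha> * N\<^sup>2) / ((\<alpha> + 1) * (\<alpha> + 2)))))"
        unfolding g_def set_integral_complex_of_real r by simp
      also have "1 / N\<^sup>2 * (N * N + ?c * (2 * (N powr \<alpha> * N\<^sup>2) / ((\<alpha> + 1) * (\<alpha> + 2))))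
        = 1 - N powr \<alpha> / (Gamma (\<beta> + 1) * (\<alpha> + 1) * (\<alpha> + 2)) * K"
      proof -
        have "1 / N\<^sup>2 * (N * N + - (K / (2 * a)) * (2 * (b * N\<^sup>2) / p)) = 1 - b / (a * p) * K" for a b p
          using N by (simp add: power2_eq_square diff_divide_distrib mult.commute)
        then show ?thesis unfolding mult.assoc[of "Gamma (\<beta> + 1)" "\<alpha> + 1"] .
      qed
      finally show ?thesis .
    qed
    have m: "case_prod f \<in> borel_measurable (borel \<Otimes>\<^sub>M borel)" "case_prod g \<in> borel_measurable (borel \<Otimes>\<^sub>M borel)"
      unfolding f_def g_def z_def by measurable
    have "norm ((LBINT t:{0..N}. LBINT s:{0..N}. f t s) - (LBINT t:{0..N}. LBINT s:{0..N}. g t s)) \<le> \<delta> * N\<^sup>2"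
      using N by (intro double_integral_diff_bound[OF m fb gb diff]) auto
    then have "norm (1 / (of_real N)\<^sup>2 * ((LBINT t:{0..N}. LBINT s:{0..N}. f t s)
        - (LBINT t:{0..N}. LBINT s:{0..N}. g t s))) \<le> \<delta>"
      using N by (simp add: norm_mult norm_divide norm_power divide_le_eq)
    then show ?thesis
      unfolding ff gg[unfolded K_def, symmetric] right_diff_distrib \<delta>_def K_def .
  qed
  then show ?thesis using C(1) by (intro exI[of _ "C * (N powr \<alpha>)\<^sup>2 / 4"]) (auto simp: N_def)
qed

text \<open>Near 0 both \<open>A * (norm k)\<^sup>2 < c\<close> and the condition of
  \<open>form_factor_bound\<close> hold, so the fourth-order error is at most
  \<open>c * (norm k)\<^sup>2\<close>.\<close>

lemma form_factor_smallo:
  assumes n: "1 \<le> n"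
  shows "(\<lambda>k. form_factor \<mu> B n k
      - of_real (1 - real n powr \<alpha> / (Gamma (\<beta> + 1) * (\<alpha> + 1) * (\<alpha> + 2)) * (norm k)\<^sup>2))
    \<in> o[at 0](\<lambda>k. of_real ((norm k)\<^sup>2))"
proof (rule landau_o.smallI)
  fix c :: real assume c: "0 < c"
  obtain A where A: "0 \<le> A" "\<And>k. (norm k)\<^sup>2 * real n powr \<alpha> \<le> 1 \<Longrightarrow>
    norm (form_factor \<mu> B n k
      - of_real (1 - real n powr \<alpha> / (Gamma (\<beta> + 1) * (\<alpha> + 1) * (\<alpha> + 2)) * (norm k)\<^sup>2))
    \<le> A * (norm k)\<^sup>2 * (norm k)\<^sup>2"
    using form_factor_bound[OF n] by blast
  have t: "((\<lambda>k::real ^ 'd. a * (norm k)\<^sup>2) \<longlongrightarrow> 0) (at 0)" for a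
    by (auto intro!: tendsto_eq_intros)
  show "\<forall>\<^sub>F k in at 0. norm (form_factor \<mu> B n k
      - of_real (1 - real n powr \<alpha> / (Gamma (\<beta> + 1) * (\<alpha> + 1) * (\<alpha> + 2)) * (norm k)\<^sup>2))
      \<le> c * norm (complex_of_real ((norm k)\<^sup>2))"
    using order_tendstoD(2)[OF t[of A] c] order_tendstoD(2)[OF t[of "real n powr \<alpha>"] zero_less_one]
  proof eventually_elim
    case (elim k)
    then have "A * (norm k)\<^sup>2 * (norm k)\<^sup>2 \<le> c * (norm k)\<^sup>2"
      by (intro mult_right_mono) auto
    with A(2)[of k] elim(2) show ?case
      unfolding norm_of_real by (simp add: mult.commute)
  qed
qed

end

theorem mainTheorem2:
  fixes \<alpha> \<beta> :: real and n :: nat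
    and \<mu> :: "'d::finite functional_vec measure"
    and B :: "real \<Rightarrow> 'd functional_vec \<Rightarrow> real ^ 'd"
  assumes "1 \<le> n" and "0 < \<beta>" "\<beta> < 1" and "0 < \<alpha>" "\<alpha> < 2"
    and "mittag_leffler_measure \<beta> \<mu>"
    and "ggBm \<alpha> \<mu> B"
  shows "((\<lambda>k. form_factor \<mu> B n k
            - of_real (1 - real n powr \<alpha> / (Gamma (\<beta> + 1) * (\<alpha> + 1) * (\<alpha> + 2)) * (norm k)\<^sup>2))
          \<in> o[at 0](\<lambda>k. of_real ((norm k)\<^sup>2))) \<and>
    (gyration_radius_sq \<mu> B n
          = real CARD('d) * (real n powr \<alpha> / (Gamma (\<beta> + 1) * (\<alpha> + 1) * (\<alpha> + 2)))) \<and>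
    (end_to_end_length_sq \<mu> B n = (LINT w|\<mu>. (norm (B (real n) w))\<^sup>2)) \<and>
    (end_to_end_length_sq \<mu> B n = real CARD('d) * (real n powr \<alpha> / Gamma (\<beta> + 1))) \<and>
    (end_to_end_length_sq \<mu> B n / ((\<alpha> + 1) * (\<alpha> + 2)) = gyration_radius_sq \<mu> B n)"
proof -
  interpret ggBm_process \<beta> \<mu> \<alpha> B
    using assms by unfold_locales auto
  show ?thesis
    \<comment> \<open>\<open>B 0\<close> is a version of zero and need not vanish identically; the
      third conjunct holds because both second moments have the same value.\<close>
    using form_factor_smallo[OF assms(1)] second_moment[of "real n"]
    by (simp add: gyration_radius[OF assms(1)] end_to_end_length mult.assoc)
qed

end
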